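(* Let $\mathcal{L}>0$, $n\ge2$, and let $\Phi:\mathbb{R}_+\to\mathbb{R}_+$ satisfy conditions (A.1), (A.2), (A.3), (A.4) and (A.5)(b) stated in the context. Let $\mathcal{X}$ be the class of all closed curves $f:\mathbb{R}/\mathcal{L}\mathbb{Z}\to\mathbb{R}^n$ of length $\mathcal{L}$ parametrized by arc-length with $\mathcal{E}_\Phi(f)<\infty$, and let $C$ be a round circle of circumference $\mathcal{L}$ (parametrized by arc-length). If $C$ minimizes $\mathcal{E}_{\Phi,4}$ in $\mathcal{X}$ (that is, $C\in\mathcal{X}$ and $\mathcal{E}_{\Phi,4}(C)\le\mathcal{E}_{\Phi,4}(f)$ for all $f\in\mathcal{X}$), then $C$ minimizes $\mathcal{E}_\Phi$ in $\mathcal{X}$, that is, $\mathcal{E}_\Phi(C)\le\mathcal{E}_\Phi(f)$ for all $f\in\mathcal{X}$.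
   Context: Notation. $\mathbb{R}_+=\{x\in\mathbb{R}: x>0\}$; $\|\cdot\|$ and $\cdot$ are the Euclidean norm and inner product of $\mathbb{R}^n$. A closed curve of length $\mathcal{L}$ parametrized by arc-length is a Lipschitz map $f:\mathbb{R}/\mathcal{L}\mathbb{Z}\to\mathbb{R}^n$ with $\|f'\|=1$ almost everywhere; $\tau=f'$ is its unit tangent vector (defined a.e.). For a function $u$ on $\mathbb{R}/\mathcal{L}\mathbb{Z}$ write $\Delta u=u(s_1)-u(s_2)$. $\mathscr{D}(f(s_1),f(s_2))$ is the distance along the curve, i.e. $\mathrm{dist}_{\mathbb{R}/\mathcal{L}\mathbb{Z}}(s_1,s_2)$, the length of the shorter arc between the two parameters. Functions. For $t>0$, $$\Lambda(t)=-\frac1t\int_t^\infty\frac{dx}{\Phi(x)},\qquad \Theta_\Phi(t)=\frac12\big(1+\Phi(t)\Lambda(t)\big).$$ Energies. $$\mathcal{E}_\Phi(f)=\iint_{(\mathbb{R}/\mathcal{L}\mathbb{Z})^2}\left(\frac1{\Phi(\|\Delta f\|)}-\frac1{\Phi(\mathscr{D}(f(s_1),f(s_2)))}\right)ds_1\,ds_2 ,$$ $$\mathcal{E}_{\Phi,4}(f)=\iint_{(\mathbb{R}/\mathcal{L}\mathbb{Z})^2}\Theta_\Phi(\|\Delta f\|)\,\big(1-\cos\psi(s_1,s_2)\big)\,\frac{ds_1\,ds_2}{\Phi(\|\Delta f\|)},$$ where $\psi(s_1,s_2)$ is the angle between $\tau(s_1)$ and $\tau(s_2)$, so $\cos\psi(s_1,s_2)=\tau(s_1)\cdot\tau(s_2)$.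 Conditions on $\Phi$ (for the given $\mathcal{L}$ and $n$). (A.1) $\Phi$ is monotonically increasing. (A.2) $\int_x^\infty \frac{dt}{\Phi(t)}<\infty$ for every $x>0$. (A.3) Let $$W_\Phi=\left\{u\in W^{1,2}(\mathbb{R}/\mathcal{L}\mathbb{Z};\mathbb{R}^n)\;:\;\iint_{(\mathbb{R}/\mathcal{L}\mathbb{Z})^2}\frac{\|\Delta u'\|^2}{\Phi(\mathrm{dist}_{\mathbb{R}/\mathcal{L}\mathbb{Z}}(s_1,s_2))}\,ds_1\,ds_2<\infty\right\}.$$ Whenever $f$ is a closed curve of length $\mathcal{L}$ parametrized by arc-length with $\mathcal{E}_\Phi(f)<\infty$, then $f\in W_\Phi\cap W^{1,\infty}(\mathbb{R}/\mathcal{L}\mathbb{Z})$ and $f$ is bi-Lipschitz. (A.4) Whenever $f\in W_\Phi\cap W^{1,\infty}(\mathbb{R}/\mathcal{L}\mathbb{Z})$ is bi-Lipschitz with $\|f'\|=1$ a.e., then $$\lim_{\epsilon\to+0}\epsilon\int_{\mathbb{R}/\mathcal{L}\mathbb{Z}}\big(\Lambda(\|f(s_1)-f(s_1+\epsilon)\|)-\Lambda(\epsilon)\big)\,ds_1=0,$$ $$\lim_{\epsilon\to+0}\int_{\mathbb{R}/\mathcal{L}\mathbb{Z}}\Lambda(\|f(s_1)-f(s_1+\epsilon)\|)\int_{s_1}^{s_1+\epsilon}\|f'(s_1)-f'(s_2)\|^2\,ds_2\,ds_1=0.$$ (A.5)(b) $\displaystyle\inf_{x\in(0,\mathcal{L}/2]}\left(\frac1{\Phi(x)}+\Lambda(x)\right)\ge0.$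 *)

theory Defs
  imports "HOL-Analysis.Analysis"
begin

text \<open>
  Functions on \<open>\<real>/L\<int>\<close> are represented by \<open>L\<close>-periodic functions on the real line, and integrals over
  \<open>\<real>/L\<int>\<close> by integrals over the fundamental domain \<open>[0, L)\<close>. The function \<open>\<Phi>\<close> lives on \<open>(0, \<infinity>)\<close>;
  its values on \<open>(-\<infinity>, 0]\<close> are irrelevant. In particular the set of parameter pairs with
  \<open>f s = f t\<close> is a null set for every arc-length parametrized curve, because \<open>\<parallel>f'\<parallel> = 1\<close> a.e.,
  so \<open>\<Phi> 0\<close> never influences an energy.
\<close>

definition circle_periodic :: "real \<Rightarrow> (real \<Rightarrow> 'b) \<Rightarrow> bool" where
  "circle_periodic L u \<longleftrightarrow> (\<forall>s. u (s + L) = u s)"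

definition circle_dist :: "real \<Rightarrow> real \<Rightarrow> real \<Rightarrow> real" where
  "circle_dist L s t = (INF k::int. \<bar>s - t - of_int k * L\<bar>)"

definition torus_nn_integral :: "real \<Rightarrow> (real \<Rightarrow> real \<Rightarrow> real) \<Rightarrow> ennreal" where
  "torus_nn_integral L g =
    (\<integral>\<^sup>+ p \<in> {0..<L} \<times> {0..<L}. ennreal (g (fst p) (snd p)) \<partial>lborel)"

text \<open>
  The signed Lebesgue integral with values in \<open>[-\<infinity>, \<infinity>]\<close>: integral of the positive part minus
  integral of the negative part (\<open>ennreal\<close> cuts off negative values). The indeterminate case
  \<open>\<infinity> - \<infinity>\<close> does not arise for the energies below: their integrands are nonnegative a.e., for
  \<open>energy\<close> since \<open>\<Phi>\<close> is increasing, for \<open>energy4\<close> under the condition \<open>cond_A5b\<close>.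
\<close>
definition torus_integral :: "real \<Rightarrow> (real \<Rightarrow> real \<Rightarrow> real) \<Rightarrow> ereal" where
  "torus_integral L g =
    enn2ereal (torus_nn_integral L g) - enn2ereal (torus_nn_integral L (\<lambda>s t. - g s t))"

text \<open>For periodic maps, being Lipschitz on the circle and on the real line is the same.\<close>
definition arclength_closed_curve :: "real \<Rightarrow> (real \<Rightarrow> real^'n) \<Rightarrow> bool" where
  "arclength_closed_curve L f \<longleftrightarrow>
    circle_periodic L f \<and> (\<exists>K. K-lipschitz_on UNIV f) \<and>
    (AE s in lborel. \<exists>v. (f has_vector_derivative v) (at s) \<and> norm v = 1)"

definition tangent :: "(real \<Rightarrow> real^'n) \<Rightarrow> real \<Rightarrow> real^'n" where
  "tangent f s = vector_derivative f (at s)"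

definition bi_lipschitz :: "real \<Rightarrow> (real \<Rightarrow> real^'n) \<Rightarrow> bool" where
  "bi_lipschitz L f \<longleftrightarrow>
    (\<exists>c K. 0 < c \<and> (\<forall>s t. c * circle_dist L s t \<le> norm (f s - f t) \<and>
                          norm (f s - f t) \<le> K * circle_dist L s t))"

definition round_circle :: "real \<Rightarrow> (real \<Rightarrow> real^'n) \<Rightarrow> bool" where
  "round_circle L C \<longleftrightarrow>
    (\<exists>p u v. norm u = 1 \<and> norm v = 1 \<and> u \<bullet> v = 0 \<and>
      (\<forall>s. C s = p + (L / (2 * pi)) *\<^sub>R
                     (cos (2 * pi * s / L) *\<^sub>R u + sin (2 * pi * s / L) *\<^sub>R v)))"

definition Lambda :: "(real \<Rightarrow> real) \<Rightarrow> real \<Rightarrow> real" where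
  "Lambda \<Phi> t = - (1 / t) * (LINT x:{t..}|lborel. 1 / \<Phi> x)"

definition Theta :: "(real \<Rightarrow> real) \<Rightarrow> real \<Rightarrow> real" where
  "Theta \<Phi> t = (1 / 2) * (1 + \<Phi> t * Lambda \<Phi> t)"

definition energy :: "real \<Rightarrow> (real \<Rightarrow> real) \<Rightarrow> (real \<Rightarrow> real^'n) \<Rightarrow> ereal" where
  "energy L \<Phi> f =
    torus_integral L (\<lambda>s t. 1 / \<Phi> (norm (f s - f t)) - 1 / \<Phi> (circle_dist L s t))"

text \<open>The cosine of the angle between two unit tangent vectors is their inner product.\<close>
definition energy4 :: "real \<Rightarrow> (real \<Rightarrow> real) \<Rightarrow> (real \<Rightarrow> real^'n) \<Rightarrow> ereal" where
  "energy4 L \<Phi> f =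
    torus_integral L (\<lambda>s t. Theta \<Phi> (norm (f s - f t)) * (1 - tangent f s \<bullet> tangent f t)
                            / \<Phi> (norm (f s - f t)))"

definition finite_energy_curves :: "real \<Rightarrow> (real \<Rightarrow> real) \<Rightarrow> (real \<Rightarrow> real^'n) set" where
  "finite_energy_curves L \<Phi> = {f. arclength_closed_curve L f \<and> energy L \<Phi> f < \<infinity>}"

definition test_function :: "real \<Rightarrow> (real \<Rightarrow> real) \<Rightarrow> bool" where
  "test_function L \<phi> \<longleftrightarrow>
    circle_periodic L \<phi> \<and> (\<forall>k. (deriv ^^ k) \<phi> differentiable_on UNIV)"

definition weak_derivative :: "real \<Rightarrow> (real \<Rightarrow> real^'n) \<Rightarrow> (real \<Rightarrow> real^'n) \<Rightarrow> bool" where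
  "weak_derivative L u v \<longleftrightarrow>
    circle_periodic L u \<and> circle_periodic L v \<and>
    set_integrable lborel {0..<L} u \<and> set_integrable lborel {0..<L} v \<and>
    (\<forall>\<phi>. test_function L \<phi> \<longrightarrow>
      (LINT s:{0..<L}|lborel. deriv \<phi> s *\<^sub>R u s) = - (LINT s:{0..<L}|lborel. \<phi> s *\<^sub>R v s))"

definition L2_circle :: "real \<Rightarrow> (real \<Rightarrow> real^'n) set" where
  "L2_circle L = {u. circle_periodic L u \<and> u \<in> borel_measurable borel \<and>
                     set_integrable lborel {0..<L} (\<lambda>s. (norm (u s))\<^sup>2)}"

definition Linf_circle :: "real \<Rightarrow> (real \<Rightarrow> real^'n) set" where
  "Linf_circle L = {u. circle_periodic L u \<and> u \<in> borel_measurable borel \<and>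
                       (\<exists>M. AE s in lborel. norm (u s) \<le> M)}"

definition W1inf :: "real \<Rightarrow> (real \<Rightarrow> real^'n) set" where
  "W1inf L = {u \<in> Linf_circle L. \<exists>v \<in> Linf_circle L. weak_derivative L u v}"

text \<open>The space \<open>W\<^sub>\<Phi>\<close>, a subspace of \<open>W\<^sup>1\<^sup>,\<^sup>2\<close>; the weak derivative \<open>v\<close> is unique up to null sets.\<close>
definition W_Phi :: "real \<Rightarrow> (real \<Rightarrow> real) \<Rightarrow> (real \<Rightarrow> real^'n) set" where
  "W_Phi L \<Phi> = {u \<in> L2_circle L. \<exists>v \<in> L2_circle L. weak_derivative L u v \<and>
      torus_nn_integral L (\<lambda>s t. (norm (v s - v t))\<^sup>2 / \<Phi> (circle_dist L s t)) < \<infinity>}"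

definition cond_A1 :: "(real \<Rightarrow> real) \<Rightarrow> bool" where
  "cond_A1 \<Phi> \<longleftrightarrow> mono_on {0<..} \<Phi>"

definition cond_A2 :: "(real \<Rightarrow> real) \<Rightarrow> bool" where
  "cond_A2 \<Phi> \<longleftrightarrow> (\<forall>x>0. set_integrable lborel {x..} (\<lambda>t. 1 / \<Phi> t))"

text \<open>The type argument of the next two conditions fixes the dimension of the ambient space.\<close>
definition cond_A3 :: "'n::finite itself \<Rightarrow> real \<Rightarrow> (real \<Rightarrow> real) \<Rightarrow> bool" where
  "cond_A3 _ L \<Phi> \<longleftrightarrow>
    (\<forall>f :: real \<Rightarrow> real^'n. arclength_closed_curve L f \<and> energy L \<Phi> f < \<infinity> \<longrightarrow>
       f \<in> W_Phi L \<Phi> \<inter> W1inf L \<and> bi_lipschitz L f)"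

definition cond_A4 :: "'n::finite itself \<Rightarrow> real \<Rightarrow> (real \<Rightarrow> real) \<Rightarrow> bool" where
  "cond_A4 _ L \<Phi> \<longleftrightarrow>
    (\<forall>f :: real \<Rightarrow> real^'n.
       f \<in> W_Phi L \<Phi> \<inter> W1inf L \<and> bi_lipschitz L f \<and>
       (AE s in lborel. \<exists>v. (f has_vector_derivative v) (at s) \<and> norm v = 1) \<longrightarrow>
       ((\<lambda>\<epsilon>. \<epsilon> * (LINT s:{0..<L}|lborel. Lambda \<Phi> (norm (f s - f (s + \<epsilon>))) - Lambda \<Phi> \<epsilon>))
          \<longlongrightarrow> 0) (at_right 0) \<and>
       ((\<lambda>\<epsilon>. LINT s:{0..<L}|lborel. Lambda \<Phi> (norm (f s - f (s + \<epsilon>))) *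
               (LINT t:{s..s + \<epsilon>}|lborel. (norm (tangent f s - tangent f t))\<^sup>2))
          \<longlongrightarrow> 0) (at_right 0))"

text \<open>The infimum is taken in the extended reals, as it could a priori be \<open>-\<infinity>\<close>.\<close>
definition cond_A5b :: "real \<Rightarrow> (real \<Rightarrow> real) \<Rightarrow> bool" where
  "cond_A5b L \<Phi> \<longleftrightarrow> (INF x\<in>{0<..L / 2}. ereal (1 / \<Phi> x + Lambda \<Phi> x)) \<ge> 0"

end

theory Submission
  imports Defs
begin

text \<open>
  Write \<open>h = 1/\<Phi>\<close>, \<open>D = \<parallel>f s - f t\<parallel>\<close> and let \<open>a\<close>, \<open>b\<close> be the components of the two tangents along the chord.
  Since \<open>(x \<Lambda>(x))' = h(x)\<close>, a function \<open>G\<close> with \<open>G'(x) = x \<Lambda>(x)\<close> gives the pointwise identity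
  \<open>h(D) = 1/2 (h + \<Lambda>)(1 - \<tau>\<^sub>1 \<bullet> \<tau>\<^sub>2) + 1/2 (h - \<Lambda>)(1 + \<tau>\<^sub>1 \<bullet> \<tau>\<^sub>2 - 2ab) - \<partial>\<^sub>1\<partial>\<^sub>2 G(D)\<close>.
  The first term is the density of \<open>energy4\<close>. The second one is nonnegative, and it vanishes identically for
  the round circle, where the chord is symmetric with respect to the two tangents. The third one, integrated
  over \<open>\<epsilon> \<le> t - s \<le> L - \<epsilon>\<close>, is a boundary term that by condition (A.4) is asymptotic to \<open>- 2 \<epsilon> L \<Lambda>(\<epsilon>)\<close>;
  this cancels against the integral of \<open>h(circle_dist L s t)\<close> up to the constant \<open>L\<^sup>2 \<Lambda>(L/2)\<close>, which does not depend
  on the curve. As \<open>\<Phi>\<close> may jump, \<open>\<Lambda>\<close> is only Lipschitz and the integration by parts is done for Lipschitz functions.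
\<close>

section \<open>Lipschitz functions of a real variable\<close>

text \<open>The tangent is only measurable, so the mixed derivative of \<open>G\<close> is never
  formed as a second derivative of a function on the plane. For fixed \<open>s\<close> the vector
  \<open>T s\<close> is a constant, and the integration in \<open>t\<close> uses only the first
  derivative of \<open>f\<close>. It leaves one boundary term at each end of the interval, both
  functions of \<open>s\<close> alone; after a translation they differ by the derivative of a
  periodic function and so have equal integrals. The lower bi-Lipschitz bound from
  \<open>cond_A3\<close> keeps chords outside the gap at length at least
  \<open>c * \<epsilon>\<close>, where all weights are bounded and \<open>Lam\<close> is Lipschitz.
  For closing the gap, \<open>cond_A5b\<close> is decisive: chords never exceed half the length, so
  the density of \<open>energy4\<close> is nonnegative, like the defect, and both truncated
  integrals increase to limits in \<open>[0, \<infinity>]\<close>. No difference of infinite terms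
  occurs, and finiteness of the energy itself suffices to let the signed boundary term
  disappear.\<close>

lemma has_vector_derivative_iff_tendsto:
  fixes f :: "real \<Rightarrow> 'a::real_normed_vector"
  shows "(f has_vector_derivative v) (at s) \<longleftrightarrow> ((\<lambda>h. (f (s + h) - f s) /\<^sub>R h) \<longlongrightarrow> v) (at 0)"
proof -
  have "norm (f (s + h) - f s - h *\<^sub>R v) / norm h = norm ((f (s + h) - f s) /\<^sub>R h - v)"
    if "h \<noteq> 0" for h
  proof -
    have "(f (s + h) - f s) /\<^sub>R h - v = (f (s + h) - f s - h *\<^sub>R v) /\<^sub>R h"
      using that by (simp add: scaleR_diff_right)
    then show ?thesis by (simp add: divide_inverse mult.commute)
  qed
  then have "((\<lambda>h. norm (f (s + h) - f s - h *\<^sub>R v) / norm h) \<longlongrightarrow> 0) (at 0) \<longleftrightarrow>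
      ((\<lambda>h. norm ((f (s + h) - f s) /\<^sub>R h - v)) \<longlongrightarrow> 0) (at 0)"
    by (intro tendsto_cong) (auto simp: eventually_at_filter)
  then show ?thesis
    unfolding has_vector_derivative_def has_derivative_at
    by (simp add: bounded_linear_scaleR_left tendsto_norm_zero_iff flip: Lim_null)
qed

lemma vector_derivative_eq_lim:
  fixes f :: "real \<Rightarrow> 'a::real_normed_vector"
  assumes "(f has_vector_derivative v) (at s)"
  shows "(\<lambda>n. real (Suc n) *\<^sub>R (f (s + 1 / Suc n) - f s)) \<longlonglongrightarrow> v"
proof -
  have "filterlim (\<lambda>n. 1 / real (Suc n)) (at 0) sequentially"
    by (rule filterlim_atI) (use LIMSEQ_Suc[OF lim_1_over_n] in auto)
  from filterlim_compose[OF assms[unfolded has_vector_derivative_iff_tendsto] this]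
  show ?thesis by simp
qed

text \<open>By continuity of \<open>f\<close>, rational increments approximate all real ones, so
  differentiability at \<open>s\<close> becomes a Cauchy condition on countably many quotients. In
  this form the set of points of differentiability is visibly Borel.\<close>

lemma differentiable_iff_rational_Cauchy:
  fixes f :: "real \<Rightarrow> 'a::banach"
  assumes cont: "continuous_on UNIV f"
  defines "q \<equiv> \<lambda>h s. (f (s + h) - f s) /\<^sub>R h"
  shows "(\<exists>v. (f has_vector_derivative v) (at s)) \<longleftrightarrow>
    (\<forall>k::nat. \<exists>m::nat. \<forall>a\<in>\<rat>. \<forall>b\<in>\<rat>. a \<noteq> 0 \<longrightarrow> b \<noteq> 0 \<longrightarrow> \<bar>a\<bar> < 1 / Suc m \<longrightarrow> \<bar>b\<bar> < 1 / Suc m \<longrightarrow>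
        dist (q a s) (q b s) \<le> 1 / Suc k)" (is "?L \<longleftrightarrow> ?R")
proof
  assume ?L
  then obtain v where v: "((\<lambda>h. q h s) \<longlongrightarrow> v) (at 0)"
    unfolding q_def has_vector_derivative_iff_tendsto by auto
  show ?R
  proof
    fix k :: nat
    have "eventually (\<lambda>h. dist (q h s) v < 1 / Suc k / 2) (at 0)"
      using v by (rule tendstoD) auto
    then obtain d where d: "d > 0" "\<And>h. h \<noteq> 0 \<Longrightarrow> \<bar>h\<bar> < d \<Longrightarrow> dist (q h s) v < 1 / Suc k / 2"
      unfolding eventually_at by (auto simp: dist_real_def)
    obtain m where m: "1 / Suc m < d"
      using reals_Archimedean[OF d(1)] by (auto simp: inverse_eq_divide)
    show "\<exists>m::nat. \<forall>a\<in>\<rat>. \<forall>b\<in>\<rat>. a \<noteq> 0 \<longrightarrow> b \<noteq> 0 \<longrightarrow> \<bar>a\<bar> < 1 / Suc m \<longrightarrow> \<bar>b\<bar> < 1 / Suc m \<longrightarrow>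
        dist (q a s) (q b s) \<le> 1 / Suc k"
    proof (intro exI[of _ m] ballI impI)
      fix a b :: real assume "a \<noteq> 0" "b \<noteq> 0" "\<bar>a\<bar> < 1 / Suc m" "\<bar>b\<bar> < 1 / Suc m"
      then have "dist (q a s) v < 1 / Suc k / 2" "dist (q b s) v < 1 / Suc k / 2"
        using m d(2) by auto
      then show "dist (q a s) (q b s) \<le> 1 / Suc k"
        using dist_triangle_half_l[of "q a s" v "1 / Suc k" "q b s"] by (simp add: dist_commute)
    qed
  qed
next
  assume R: ?R
  have "Cauchy (\<lambda>n. q (1 / Suc n) s)"
    unfolding metric_Cauchy_iff2
  proof
    fix k
    \<comment> \<open>The assumption bounds distances only weakly, while the Cauchy criterion asks
      for less than \<open>inverse (Suc k)\<close>; hence it is used at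
      \<open>Suc k\<close>.\<close>
    obtain m where m: "\<And>a b. a \<in> \<rat> \<Longrightarrow> b \<in> \<rat> \<Longrightarrow> a \<noteq> 0 \<Longrightarrow> b \<noteq> 0 \<Longrightarrow> \<bar>a\<bar> < 1 / Suc m \<Longrightarrow>
        \<bar>b\<bar> < 1 / Suc m \<Longrightarrow> dist (q a s) (q b s) \<le> 1 / Suc (Suc k)"
      using R by blast
    have "dist (q (1 / Suc i) s) (q (1 / Suc j) s) \<le> 1 / Suc (Suc k)" if "i \<ge> Suc m" "j \<ge> Suc m" for i j
      by (rule m) (use that in \<open>auto simp: field_simps\<close>)
    moreover have "1 / real (Suc (Suc k)) < inverse (Suc k)" by (simp add: field_simps)
    ultimately show "\<exists>M. \<forall>i\<ge>M. \<forall>j\<ge>M. dist (q (1 / Suc i) s) (q (1 / Suc j) s) < inverse (Suc k)"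
      by (meson le_less_trans)
  qed
  then obtain v where v: "(\<lambda>n. q (1 / Suc n) s) \<longlonglongrightarrow> v"
    using convergent_eq_Cauchy by blast
  have "((\<lambda>h. q h s) \<longlongrightarrow> v) (at 0)"
  proof (rule tendstoI)
    fix e :: real assume "e > 0"
    obtain k where k: "1 / Suc k < e"
      using reals_Archimedean[OF \<open>e > 0\<close>] by (auto simp: inverse_eq_divide)
    obtain m where m: "\<And>a b. a \<in> \<rat> \<Longrightarrow> b \<in> \<rat> \<Longrightarrow> a \<noteq> 0 \<Longrightarrow> b \<noteq> 0 \<Longrightarrow> \<bar>a\<bar> < 1 / Suc m \<Longrightarrow>
        \<bar>b\<bar> < 1 / Suc m \<Longrightarrow> dist (q a s) (q b s) \<le> 1 / Suc k"
      using R by blast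
    have rat: "dist (q a s) v \<le> 1 / Suc k" if "a \<in> \<rat>" "a \<noteq> 0" "\<bar>a\<bar> < 1 / Suc m" for a
    proof (rule LIMSEQ_le_const2[OF tendsto_dist[OF tendsto_const v]])
      show "\<exists>N. \<forall>n\<ge>N. dist (q a s) (q (1 / Suc n) s) \<le> 1 / Suc k"
        by (rule exI[of _ "Suc m"], intro allI impI m that) (auto simp: field_simps)
    qed
    have "dist (q h s) v \<le> 1 / Suc k" if h: "h \<noteq> 0" "\<bar>h\<bar> < 1 / Suc m" for h
    proof -
      \<comment> \<open>The approximating rationals must avoid 0, because the Cauchy condition
        speaks of nonzero increments only; removing 0 keeps the interval open, so the rationals stay
        dense in it.\<close>
      have "h \<in> closure (\<rat> \<inter> ({-1 / Suc m<..<1 / Suc m} - {0}))"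
      proof -
        have "closure (({-1 / Suc m<..<1 / Suc m} - {0}) \<inter> \<rat>) =
            closure ({-1 / Suc m<..<1 / Suc m} - {0::real})"
          by (rule closure_open_Int_superset) (auto simp: Rats_closure_real open_delete)
        moreover have "h \<in> {-1 / Suc m<..<1 / Suc m} - {0::real}" using h by auto
        ultimately show ?thesis using closure_subset by (metis Int_commute subsetD)
      qed
      then obtain r where r: "\<And>n. r n \<in> \<rat> \<inter> ({-1 / Suc m<..<1 / Suc m} - {0})" "r \<longlonglongrightarrow> h"
        unfolding closure_sequential by blast
      have "(\<lambda>n. q (r n) s) \<longlonglongrightarrow> q h s"
        unfolding q_def using h(1)
        by (intro tendsto_intros r continuous_on_tendsto_compose[OF cont]) auto
      then show ?thesis
        by (intro LIMSEQ_le_const2[OF tendsto_dist[OF _ tendsto_const]])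
          (use rat r(1) in \<open>auto intro!: exI[of _ 0] simp: abs_less_iff minus_less_iff simp del: of_nat_Suc\<close>)
    qed
    with k show "eventually (\<lambda>h. dist (q h s) v < e) (at 0)"
      unfolding eventually_at by (intro exI[of _ "1 / Suc m"]) (force simp: dist_real_def)
  qed
  then show ?L unfolding q_def has_vector_derivative_iff_tendsto by auto
qed

lemma borel_measurable_vector_derivative:
  fixes f :: "real \<Rightarrow> 'a::euclidean_space"
  assumes cont: "continuous_on UNIV f"
  shows "(\<lambda>s. vector_derivative f (at s)) \<in> borel_measurable borel"
proof -
  define P where "P s \<longleftrightarrow> (\<exists>v. (f has_vector_derivative v) (at s))" for s
  have f[measurable]: "f \<in> borel_measurable borel"
    using cont by (rule borel_measurable_continuous_onI)
  have [measurable]: "Measurable.pred borel P"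
    unfolding P_def differentiable_iff_rational_Cauchy[OF cont]
    by (intro measurable pred_intros_countable pred_intros_countable_bounded pred_intros_logic countable_rat)
      measurable
  \<comment> \<open>\<open>vector_derivative\<close> is a choice. Where no derivative exists it
    chooses from the empty predicate, so all these points share this one default value.\<close>
  define c :: 'a where "c = (SOME v. False)"
  have "vector_derivative f (at s) =
      lim (\<lambda>n. if P s then real (Suc n) *\<^sub>R (f (s + 1 / Suc n) - f s) else c)" for s
  proof (cases "P s")
    case True
    then obtain v where v: "(f has_vector_derivative v) (at s)" by (auto simp: P_def)
    from limI[OF vector_derivative_eq_lim[OF v]] vector_derivative_at[OF v] True
    show ?thesis by simp
  next
    case False
    then have "(\<lambda>v. (f has_vector_derivative v) (at s)) = (\<lambda>v. False)" by (auto simp: P_def)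
    then have "vector_derivative f (at s) = c"
      unfolding vector_derivative_def c_def by simp
    with False show ?thesis by (simp add: lim_const)
  qed
  then show ?thesis by simp
qed

text \<open>Dominated convergence: the difference quotients of \<open>F\<close> are bounded by
  \<open>K\<close> and converge almost everywhere to \<open>F'\<close>, while their integrals are
  difference quotients at \<open>b\<close> and \<open>a\<close> of a primitive of \<open>F\<close>,
  which tend to \<open>F b - F a\<close>.\<close>

lemma integral_vector_derivative_lipschitz:
  fixes F F' :: "real \<Rightarrow> 'a::euclidean_space"
  assumes ab: "a \<le> b" and lip: "K-lipschitz_on {a..b} F"
    and [measurable]: "F' \<in> borel_measurable borel"
    and deriv: "AE x in lborel. a < x \<longrightarrow> x < b \<longrightarrow> (F has_vector_derivative F' x) (at x)"
  shows "set_integrable lborel {a..b} F'" "(LINT x:{a..b}|lborel. F' x) = F b - F a"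
proof -
  \<comment> \<open>Constant continuation beyond the interval keeps the Lipschitz constant and makes
    the forward quotients meaningful up to \<open>b\<close>.\<close>
  define G where "G x = F (max a (min b x))" for x
  have lipG: "norm (G x - G y) \<le> K * \<bar>x - y\<bar>" for x y
  proof -
    have "norm (G x - G y) \<le> K * \<bar>max a (min b x) - max a (min b y)\<bar>"
      unfolding G_def using lipschitz_on_normD[OF lip, of "max a (min b x)" "max a (min b y)"] ab by auto
    also have "\<dots> \<le> K * \<bar>x - y\<bar>"
      using lipschitz_on_nonneg[OF lip] by (intro mult_left_mono) auto
    finally show ?thesis .
  qed
  have contG: "continuous_on A G" for A
    by (rule lipschitz_on_continuous_on[where L=K], rule lipschitz_onI)
      (use lipG lipschitz_on_nonneg[OF lip] in \<open>auto simp: dist_norm\<close>)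
  have [measurable]: "G \<in> borel_measurable borel"
    using contG by (rule borel_measurable_continuous_onI)
  define q where "q n x = real (Suc n) *\<^sub>R (G (x + 1 / Suc n) - G x)" for n x
  have [measurable]: "q n \<in> borel_measurable borel" for n unfolding q_def by measurable
  \<comment> \<open>The margins leave room for \<open>x + 1 / Suc n \<le> b + 1\<close> inside the
    open interval, so that two-sided derivatives are available.\<close>
  obtain P where P: "\<And>x. x \<in> {a - 1..b + 2} \<Longrightarrow> (P has_vector_derivative G x) (at x within {a - 1..b + 2})"
    using antiderivative_continuous[OF contG] by metis
  have P': "(P has_vector_derivative G x) (at x)" if "a - 1 < x" "x < b + 2" for x
    using P[of x] that by (simp add: at_within_Icc_at)
  have int_q: "(\<integral>x. indicator {a..b} x *\<^sub>R q n x \<partial>lborel) =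
      real (Suc n) *\<^sub>R (P (b + 1 / Suc n) - P b) - real (Suc n) *\<^sub>R (P (a + 1 / Suc n) - P a)" for n
  proof (subst integral_FTC_Icc[OF ab, where F="\<lambda>x. real (Suc n) *\<^sub>R (P (x + 1 / Suc n) - P x)"])
    fix x assume x: "a \<le> x" "x \<le> b"
    have le1: "1 / real (Suc n) \<le> 1" "0 < 1 / real (Suc n)" by simp_all
    have "((\<lambda>y. y + 1 / real (Suc n)) has_real_derivative 1) (at x)"
      by (auto intro!: derivative_eq_intros)
    from vector_diff_chain_at[OF this[unfolded has_real_derivative_iff_has_vector_derivative], of P "G (x + 1 / Suc n)"]
    have "((\<lambda>y. P (y + 1 / Suc n)) has_vector_derivative G (x + 1 / Suc n)) (at x)"
      using P'[of "x + 1 / Suc n"] x le1 by (simp add: o_def del: of_nat_Suc)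
    from has_vector_derivative_scaleR[OF DERIV_const[of "real (Suc n)"] has_vector_derivative_diff[OF this P'[of x]]] x
    show "((\<lambda>x. real (Suc n) *\<^sub>R (P (x + 1 / Suc n) - P x)) has_vector_derivative q n x) (at x within {a..b})"
      unfolding q_def by (auto intro: has_vector_derivative_at_within)
  next
    show "continuous_on {a..b} (q n)"
      unfolding q_def by (intro continuous_intros continuous_on_compose2[OF contG[of UNIV]]) auto
  qed simp
  have lim: "(\<lambda>n. \<integral>x. indicator {a..b} x *\<^sub>R q n x \<partial>lborel) \<longlonglongrightarrow> F b - F a"
  proof -
    have "F b = G b" "F a = G a" using ab by (auto simp: G_def)
    then show ?thesis unfolding int_q
      using vector_derivative_eq_lim[OF P'[of b]] vector_derivative_eq_lim[OF P'[of a]] ab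
      by (auto intro!: tendsto_diff)
  qed
  have AEF: "AE x in lborel. (\<lambda>n. indicator {a..b} x *\<^sub>R q n x) \<longlonglongrightarrow> indicator {a..b} x *\<^sub>R F' x"
    using deriv AE_lborel_singleton[of a] AE_lborel_singleton[of b]
  proof eventually_elim
    case (elim x)
    show ?case
    proof (cases "x \<in> {a..b}")
      case True
      with elim have x: "a < x" "x < b" "(F has_vector_derivative F' x) (at x)" by auto
      have "(G has_vector_derivative F' x) (at x)"
        using x(3) by (rule has_vector_derivative_transform_within_open[where S="{a<..<b}"])
          (use x in \<open>auto simp: G_def\<close>)
      from vector_derivative_eq_lim[OF this] show ?thesis
        unfolding q_def by (intro tendsto_scaleR tendsto_const)
    qed simp
  qed
  have bound: "norm (indicator {a..b} x *\<^sub>R q n x) \<le> indicator {a..b} x * K" for x n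
  proof -
    have "norm (q n x) \<le> real (Suc n) * (K * (1 / Suc n))"
      unfolding q_def norm_scaleR using lipG[of "x + 1 / Suc n" x]
      by (intro mult_mono) (auto simp del: of_nat_Suc)
    then have "norm (q n x) \<le> K" by (simp del: of_nat_Suc)
    then show ?thesis by (auto simp: indicator_def)
  qed
  have int_w: "integrable lborel (\<lambda>x. indicator {a..b} x * K)"
    by (intro integrable_mult_left integrable_real_indicator) (use ab in auto)
  have dc: "integrable lborel (\<lambda>x. indicator {a..b} x *\<^sub>R F' x)"
    "(\<lambda>n. \<integral>x. indicator {a..b} x *\<^sub>R q n x \<partial>lborel) \<longlonglongrightarrow> (\<integral>x. indicator {a..b} x *\<^sub>R F' x \<partial>lborel)"
    using AEF int_w bound
    by (auto intro!: integrable_dominated_convergence[where w="\<lambda>x. indicator {a..b} x * K" and s="\<lambda>n x. indicator {a..b} x *\<^sub>R q n x"]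
        integral_dominated_convergence[where w="\<lambda>x. indicator {a..b} x * K"])
  from dc show "set_integrable lborel {a..b} F'" by (simp add: set_integrable_def)
  from LIMSEQ_unique[OF dc(2) lim] show "(LINT x:{a..b}|lborel. F' x) = F b - F a"
    by (simp add: set_lebesgue_integral_def)
qed

section \<open>A chain rule almost everywhere\<close>

lemma countable_if_no_limit_points:
  fixes S :: "'a::second_countable_topology set"
  assumes "\<And>x. x \<in> S \<Longrightarrow> \<not> x islimpt S"
  shows "countable S"
proof -
  obtain B :: "'a set set" where B: "countable B" "topological_basis B"
    using ex_countable_basis by blast
  have "\<exists>U\<in>B. U \<inter> S = {x}" if x: "x \<in> S" for x
  proof -
    obtain T where T: "x \<in> T" "open T" "\<And>y. y \<in> S \<Longrightarrow> y \<in> T \<Longrightarrow> y = x"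
      using assms[OF x] unfolding islimpt_def by blast
    from topological_basisE[OF B(2) T(2,1)] obtain U where "U \<in> B" "x \<in> U" "U \<subseteq> T" by metis
    with T x show ?thesis by blast
  qed
  then obtain U where U: "\<And>x. x \<in> S \<Longrightarrow> U x \<in> B \<and> U x \<inter> S = {x}" by metis
  have "inj_on U S" using U by (intro inj_onI) (metis singleton_inject)
  moreover have "countable (U ` S)" using U B(1) by (intro countable_subset[of "U ` S" B]) auto
  ultimately show ?thesis by (simp add: countable_image_inj_eq)
qed

text \<open>A point with nonzero derivative is isolated in its level set, since the difference
  quotient stays away from 0 nearby. Isolated points of a level are countably many, and there are
  countably many levels.\<close>

lemma countable_noncritical_level_set:
  fixes D :: "real \<Rightarrow> real"
  assumes "countable N"
  shows "countable {t. D t \<in> N \<and> (\<exists>d. d \<noteq> 0 \<and> (D has_real_derivative d) (at t))}"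
proof -
  have "countable {t. D t = c \<and> (\<exists>d. d \<noteq> 0 \<and> (D has_real_derivative d) (at t))}" (is "countable ?S") for c
  proof (rule countable_if_no_limit_points)
    fix t assume "t \<in> ?S"
    then obtain d where d: "D t = c" "d \<noteq> 0" "(D has_real_derivative d) (at t)" by auto
    from d(3) have "((\<lambda>y. (D y - D t) / (y - t)) \<longlongrightarrow> d) (at t)" by (simp add: has_field_derivative_iff)
    from tendsto_imp_eventually_ne[OF this d(2)]
    have "eventually (\<lambda>y. y \<notin> ?S) (at t)" by eventually_elim (use d(1) in auto)
    then show "\<not> t islimpt ?S" by (simp add: islimpt_iff_eventually)
  qed
  then have "countable (\<Union>c\<in>N. {t. D t = c \<and> (\<exists>d. d \<noteq> 0 \<and> (D has_real_derivative d) (at t))})"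
    using assms by blast
  then show ?thesis by (rule countable_subset[rotated]) auto
qed

text \<open>Where \<open>g\<close> fails to be differentiable, the Lipschitz bound gives derivative \<open>0\<close> at critical points
  of \<open>D\<close>, and by \<open>countable_noncritical_level_set\<close> only countably many points remain.\<close>
lemma AE_chain_rule_lipschitz:
  fixes g D :: "real \<Rightarrow> real"
  assumes T: "open T" and lip: "K-lipschitz_on T g" and N: "countable N"
    and g: "\<And>x. x \<in> T \<Longrightarrow> x \<notin> N \<Longrightarrow> (g has_real_derivative g' x) (at x)"
  shows "AE t in lborel. \<forall>d. D t \<in> T \<longrightarrow> (D has_real_derivative d) (at t) \<longrightarrow>
           ((\<lambda>t. g (D t)) has_real_derivative g' (D t) * d) (at t)"
proof -
  have "AE t in lborel. t \<notin> {t. D t \<in> N \<and> (\<exists>d. d \<noteq> 0 \<and> (D has_real_derivative d) (at t))}"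
    by (intro AE_not_in countable_imp_null_set_lborel countable_noncritical_level_set N)
  then show ?thesis
  proof eventually_elim
    case (elim t)
    show ?case
    proof (intro allI impI)
      fix d assume t: "D t \<in> T" and d: "(D has_real_derivative d) (at t)"
      show "((\<lambda>t. g (D t)) has_real_derivative g' (D t) * d) (at t)"
      proof (cases "D t \<in> N")
        case False
        from DERIV_chain2[OF g[OF t False] d] show ?thesis .
      next
        case True
        with elim d have d0: "d = 0" by auto
        have "((\<lambda>y. (D y - D t) / (y - t)) \<longlongrightarrow> 0) (at t)" using d d0 by (simp add: has_field_derivative_iff)
        then have lim0: "((\<lambda>y. K * norm ((D y - D t) / (y - t))) \<longlongrightarrow> 0) (at t)"
          by (intro tendsto_mult_right_zero tendsto_norm_zero)
        have "eventually (\<lambda>y. D y \<in> T) (at t)"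
          using DERIV_isCont[OF d] T t unfolding isCont_def by (auto dest: topological_tendstoD)
        then have "eventually (\<lambda>y. norm ((g (D y) - g (D t)) / (y - t)) \<le> K * norm ((D y - D t) / (y - t))) (at t)"
        proof eventually_elim
          case (elim y)
          from lipschitz_on_normD[OF lip elim t] show ?case
            by (simp add: divide_right_mono)
        qed
        from Lim_null_comparison[OF this lim0] show ?thesis by (simp add: has_field_derivative_iff d0)
      qed
    qed
  qed
qed

section \<open>Auxiliary facts on null sets, derivatives and measurability\<close>

lemma AE_lborel_shift:
  fixes a :: real
  assumes "AE x in lborel. P x"
  shows "AE x in lborel. P (x + a)"
proof -
  obtain N where N: "N \<in> null_sets lborel" "{x. \<not> P x} \<subseteq> N"
    using assms by (auto elim!: AE_E simp: null_sets_def)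
  have [measurable]: "N \<in> sets borel" using N(1) by (auto simp: null_sets_def)
  have "AE x in lborel. x \<notin> N" using N(1) by (rule AE_not_in)
  then have "AE x in lborel. a + 1 * x \<notin> N"
    by (intro AE_borel_affine) auto
  then show ?thesis
    by eventually_elim (use N(2) in \<open>auto simp: add.commute\<close>)
qed

lemma AE_lborel_prodI:
  fixes P :: "real \<times> real \<Rightarrow> bool"
  assumes [measurable]: "Measurable.pred borel P" and "AE s in lborel. AE t in lborel. P (s, t)"
  shows "AE p in lborel \<Otimes>\<^sub>M lborel. P p"
proof -
  have [measurable]: "Measurable.pred (lborel \<Otimes>\<^sub>M lborel) P" by (simp add: lborel_prod)
  show ?thesis
    by (rule lborel_pair.AE_pair_measure[OF _ assms(2)]) measurable
qed

lemma has_real_derivative_inner: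
  fixes g k :: "real \<Rightarrow> 'a::real_inner"
  assumes "(g has_vector_derivative g') (at t)" "(k has_vector_derivative k') (at t)"
  shows "((\<lambda>t. g t \<bullet> k t) has_real_derivative g t \<bullet> k' + g' \<bullet> k t) (at t)"
  using has_derivative_inner[OF assms[unfolded has_vector_derivative_def]]
  unfolding has_field_derivative_def
  by (rule has_derivative_eq_rhs) (auto simp: fun_eq_iff algebra_simps)

lemma has_real_derivative_norm:
  fixes g :: "real \<Rightarrow> 'a::real_inner"
  assumes "(g has_vector_derivative g') (at t)" "g t \<noteq> 0"
  shows "((\<lambda>t. norm (g t)) has_real_derivative (g t \<bullet> g') / norm (g t)) (at t)"
proof -
  have "((\<lambda>t. g t \<bullet> g t) has_real_derivative 2 * (g t \<bullet> g')) (at t)"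
    using has_real_derivative_inner[OF assms(1) assms(1)] by (simp add: inner_commute)
  from DERIV_chain2[OF DERIV_real_sqrt this] assms(2)
  show ?thesis by (simp add: norm_eq_sqrt_inner field_simps)
qed

lemma lipschitz_on_mult_bounded:
  fixes u v :: "'a::metric_space \<Rightarrow> real"
  assumes u: "K-lipschitz_on S u" "\<And>x. x \<in> S \<Longrightarrow> \<bar>u x\<bar> \<le> A"
    and v: "M-lipschitz_on S v" "\<And>x. x \<in> S \<Longrightarrow> \<bar>v x\<bar> \<le> B" and nonneg: "0 \<le> A" "0 \<le> B"
  shows "(K * B + A * M)-lipschitz_on S (\<lambda>x. u x * v x)"
proof (rule lipschitz_onI)
  fix x y assume xy: "x \<in> S" "y \<in> S"
  have "u x * v x - u y * v y = (u x - u y) * v x + u y * (v x - v y)" by (simp add: algebra_simps)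
  also have "\<bar>\<dots>\<bar> \<le> \<bar>u x - u y\<bar> * \<bar>v x\<bar> + \<bar>u y\<bar> * \<bar>v x - v y\<bar>"
    by (rule order_trans[OF abs_triangle_ineq]) (simp add: abs_mult)
  also have "\<dots> \<le> (K * dist x y) * B + A * (M * dist x y)"
    using xy u v nonneg lipschitz_onD[OF u(1) xy] lipschitz_onD[OF v(1) xy] lipschitz_on_nonneg[OF u(1)]
    by (intro add_mono mult_mono) (auto simp: dist_real_def)
  finally show "dist (u x * v x) (u y * v y) \<le> (K * B + A * M) * dist x y"
    by (simp add: dist_real_def algebra_simps)
qed (use nonneg lipschitz_on_nonneg[OF u(1)] lipschitz_on_nonneg[OF v(1)] in auto)

text \<open>The moving interval is turned into a condition on the pair \<open>(s, t)\<close> inside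
  the integrand, after which measurability of parameter integrals applies.\<close>

lemma borel_measurable_oscillation:
  fixes \<tau> :: "real \<Rightarrow> 'a::euclidean_space"
  assumes [measurable]: "\<tau> \<in> borel_measurable borel"
  shows "(\<lambda>s. LINT t:{s..s + \<epsilon>}|lborel. (norm (\<tau> s - \<tau> t))\<^sup>2) \<in> borel_measurable borel"
proof -
  have "(\<lambda>s. LINT t:{s..s + \<epsilon>}|lborel. (norm (\<tau> s - \<tau> t))\<^sup>2) =
      (\<lambda>s. \<integral>t. (if s \<le> t \<and> t \<le> s + \<epsilon> then (norm (\<tau> s - \<tau> t))\<^sup>2 else 0) \<partial>lborel)"
    unfolding set_lebesgue_integral_def
    by (intro ext Bochner_Integration.integral_cong) (auto simp: indicator_def)
  also have "\<dots> \<in> borel_measurable borel" by measurable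
  finally show ?thesis .
qed

section \<open>Periodic functions\<close>

lemma circle_dist_add:
  assumes "0 \<le> r" "r \<le> L"
  shows "circle_dist L s (s + r) = min r (L - r)"
  unfolding circle_dist_def
proof (rule antisym)
  have bdd: "bdd_below (range (\<lambda>k::int. \<bar>s - (s + r) - of_int k * L\<bar>))"
    by (rule bdd_belowI[of _ 0]) auto
  \<comment> \<open>The values 0 and -1 of \<open>k\<close> realise the two arcs between the
    parameters.\<close>
  have "(INF k::int. \<bar>s - (s + r) - of_int k * L\<bar>) \<le> \<bar>s - (s + r) - of_int 0 * L\<bar>"
    "(INF k::int. \<bar>s - (s + r) - of_int k * L\<bar>) \<le> \<bar>s - (s + r) - of_int (-1) * L\<bar>"
    by (intro cINF_lower bdd UNIV_I)+
  then show "(INF k::int. \<bar>s - (s + r) - of_int k * L\<bar>) \<le> min r (L - r)"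
    using assms by auto
next
  show "min r (L - r) \<le> (INF k::int. \<bar>s - (s + r) - of_int k * L\<bar>)"
  proof (rule cINF_greatest)
    fix k :: int
    consider "k \<ge> 0" | "k \<le> -1" by linarith
    then show "min r (L - r) \<le> \<bar>s - (s + r) - of_int k * L\<bar>"
    proof cases
      case 1
      then have "of_int k * L \<ge> 0" using assms by simp
      then show ?thesis using assms by simp
    next
      case 2
      then have "of_int k * L \<le> -1 * L" using assms by (intro mult_right_mono) auto
      then show ?thesis using assms by simp
    qed
  qed simp
qed

lemma circle_dist_add_period: "circle_dist L s (t + L) = circle_dist L s t"
proof -
  have "range (\<lambda>k::int. \<bar>s - (t + L) - of_int k * L\<bar>) =
      (\<lambda>k::int. \<bar>s - t - of_int k * L\<bar>) ` range (\<lambda>k. k + 1)"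
    unfolding image_image by (simp add: algebra_simps)
  also have "range (\<lambda>k::int. k + 1) = UNIV" by (auto intro: image_eqI[of _ _ "x - 1" for x])
  finally show ?thesis unfolding circle_dist_def by simp
qed

lemma borel_measurable_circle_dist[measurable]:
  assumes [measurable]: "f \<in> borel_measurable M" "g \<in> borel_measurable M"
  shows "(\<lambda>x. circle_dist L (f x) (g x)) \<in> borel_measurable M"
  unfolding circle_dist_def by (rule borel_measurable_cINF_real) (auto intro!: bdd_belowI[of _ 0])

lemma nn_integral_periodic:
  fixes q :: "real \<Rightarrow> ennreal"
  assumes [measurable]: "q \<in> borel_measurable borel" and per: "\<And>x. q (x + L) = q x"
    and a: "0 \<le> a" "a \<le> L"
  shows "(\<integral>\<^sup>+x. q x * indicator {a..<a + L} x \<partial>lborel) = (\<integral>\<^sup>+x. q x * indicator {0..<L} x \<partial>lborel)"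
proof -
  have "(\<integral>\<^sup>+x. q x * indicator {L..<a + L} x \<partial>lborel) =
      (\<integral>\<^sup>+x. q x * indicator {0..<a} x \<partial>lborel)"
    by (subst nn_integral_real_affine[where c=1 and t=L])
      (auto intro!: nn_integral_cong simp: per add.commute indicator_def)
  moreover have "(\<integral>\<^sup>+x. q x * indicator {a..<a + L} x \<partial>lborel) =
      (\<integral>\<^sup>+x. q x * indicator {a..<L} x + q x * indicator {L..<a + L} x \<partial>lborel)"
    using a by (auto intro!: nn_integral_cong split: split_indicator)
  moreover have "(\<integral>\<^sup>+x. q x * indicator {0..<L} x \<partial>lborel) =
      (\<integral>\<^sup>+x. q x * indicator {a..<L} x + q x * indicator {0..<a} x \<partial>lborel)"
    using a by (auto intro!: nn_integral_cong split: split_indicator)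
  ultimately show ?thesis by (simp add: nn_integral_add)
qed

lemma integral_periodic_shift:
  fixes q :: "real \<Rightarrow> real"
  assumes [measurable]: "q \<in> borel_measurable borel" and int: "set_integrable lborel {0..<L} q"
    and per: "\<And>x. q (x + L) = q x" and a: "0 \<le> a" "a \<le> L"
  shows "(LINT x:{0..<L}|lborel. q (x + a)) = (LINT x:{0..<L}|lborel. q x)"
proof -
  have int1: "set_integrable lborel {a..<L} q" "set_integrable lborel {0..<a} q"
    using a by (auto intro: set_integrable_subset[OF int])
  have eq: "indicat_real {L..<L + a} (L + x) *\<^sub>R q (L + x) = indicat_real {0..<a} x *\<^sub>R q x" for x
    by (simp add: per add.commute[of L] indicator_def)
  have int2: "set_integrable lborel {L..<L + a} q"
    using int1(2) lborel_integrable_real_affine_iff[of 1 "\<lambda>x. indicat_real {L..<L + a} x *\<^sub>R q x" L]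
    unfolding set_integrable_def by (simp add: eq del: real_scaleR_def)
  have "(LINT x:{0..<L}|lborel. q (x + a)) = (LINT x:{a..<L + a}|lborel. q x)"
    unfolding set_lebesgue_integral_def
    by (subst (2) lborel_integral_real_affine[where c=1 and t=a])
      (auto intro!: Bochner_Integration.integral_cong simp: add.commute indicator_def)
  also have "{a..<L + a} = {a..<L} \<union> {L..<L + a}" using a by auto
  also have "(LINT x:({a..<L} \<union> {L..<L + a})|lborel. q x) =
      (LINT x:{a..<L}|lborel. q x) + (LINT x:{L..<L + a}|lborel. q x)"
    by (intro set_integral_Un int1 int2) auto
  also have "(LINT x:{L..<L + a}|lborel. q x) = (LINT x:{0..<a}|lborel. q x)"
    unfolding set_lebesgue_integral_def
    by (subst lborel_integral_real_affine[where c=1 and t=L]) (simp_all add: eq del: real_scaleR_def)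
  also have "(LINT x:{a..<L}|lborel. q x) + (LINT x:{0..<a}|lborel. q x) =
      (LINT x:({a..<L} \<union> {0..<a})|lborel. q x)"
    by (intro set_integral_Un[symmetric] int1) auto
  also have "{a..<L} \<union> {0..<a} = {0..<L}" using a by auto
  finally show ?thesis .
qed

section \<open>Decreasing weights\<close>

text \<open>The model is \<open>1 / \<Phi>\<close> on the positive axis. Setting it to 0 elsewhere
  discards the arbitrary values of \<open>\<Phi>\<close> there and makes the weight Borel on the
  whole line.\<close>

locale decreasing_weight =
  fixes h :: "real \<Rightarrow> real"
  assumes h_pos: "0 < x \<Longrightarrow> 0 < h x"
    and h_nonpos_arg: "x \<le> 0 \<Longrightarrow> h x = 0"
    and h_antimono: "0 < x \<Longrightarrow> x \<le> y \<Longrightarrow> h y \<le> h x"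
    and h_tail: "0 < x \<Longrightarrow> set_integrable lborel {x..} h"
begin

definition H :: "real \<Rightarrow> real" where
  "H x = (LINT t:{x..}|lborel. h t)"

text \<open>This agrees with \<open>Lambda \<Phi>\<close> for nonnegative arguments; the value 0
  elsewhere serves measurability.\<close>

definition Lam :: "real \<Rightarrow> real" where
  "Lam x = (if 0 < x then - H x / x else 0)"

lemma borel_measurable_h[measurable]: "h \<in> borel_measurable borel"
proof -
  have "(\<lambda>x. - h x) \<in> borel_measurable borel"
    by (rule borel_measurable_piecewise_mono[of "{{0<..}, {..0}}"])
      (auto simp: h_nonpos_arg intro!: mono_onI h_antimono)
  then show ?thesis by simp
qed

lemma h_nonneg: "0 \<le> h x"
  using h_pos[of x] h_nonpos_arg[of x] by (cases "0 < x") auto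

lemma H_nonneg: "0 \<le> H x"
  unfolding H_def set_lebesgue_integral_def by (simp add: h_nonneg)

lemma H_diff:
  assumes "0 < x" "x \<le> y"
  shows "(LINT t:{x..y}|lborel. h t) = H x - H y"
proof -
  have "{x..} = {x..y} \<union> {y..}" using assms by auto
  moreover have "(LINT t:({x..y} \<union> {y..})|lborel. h t) =
      (LINT t:{x..y}|lborel. h t) + (LINT t:{y..}|lborel. h t)"
  proof (rule set_integral_Un_AE)
    show "AE t in lborel. \<not> (t \<in> {x..y} \<and> t \<in> {y..})"
      using AE_lborel_singleton[of y] by eventually_elim auto
    show "set_integrable lborel {x..y} h"
      by (rule set_integrable_subset[OF h_tail[OF assms(1)]]) auto
    show "set_integrable lborel {y..} h" using assms by (intro h_tail) auto
  qed auto
  ultimately show ?thesis by (simp add: H_def)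
qed

text \<open>On \<open>[x, y]\<close> the weight lies between \<open>h y\<close> and
  \<open>h x\<close>. These bounds replace continuity of \<open>h\<close>: they yield monotonicity
  and the Lipschitz bound for \<open>H\<close>, and its derivative at continuity points of
  \<open>h\<close>.\<close>

lemma H_sandwich:
  assumes "0 < x" "x \<le> y"
  shows "h y * (y - x) \<le> H x - H y" "H x - H y \<le> h x * (y - x)"
proof -
  have int: "set_integrable lborel {x..y} h"
    by (rule set_integrable_subset[OF h_tail[OF assms(1)]]) auto
  have const: "set_integrable lborel {x..y} (\<lambda>_. c)" "(LINT t:{x..y}|lborel. c) = c * (y - x)" for c :: real
    using assms by (auto simp: set_integrable_def set_lebesgue_integral_def)
  show "h y * (y - x) \<le> H x - H y"
    unfolding H_diff[OF assms, symmetric] const(2)[symmetric]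
    by (rule set_integral_mono) (use assms int const in \<open>auto intro: h_antimono\<close>)
  show "H x - H y \<le> h x * (y - x)"
    unfolding H_diff[OF assms, symmetric] const(2)[symmetric]
    by (rule set_integral_mono) (use assms int const in \<open>auto intro: h_antimono\<close>)
qed

lemma H_antimono: "0 < x \<Longrightarrow> x \<le> y \<Longrightarrow> H y \<le> H x"
  using H_sandwich(1)[of x y] h_nonneg[of y] mult_nonneg_nonneg[of "h y" "y - x"] by linarith

lemma lipschitz_on_H:
  assumes "0 < \<delta>"
  shows "(h \<delta>)-lipschitz_on {\<delta>..} H"
proof (rule lipschitz_onI)
  have le: "\<bar>H x - H y\<bar> \<le> h \<delta> * (y - x)" if "\<delta> \<le> x" "x \<le> y" for x y
  proof -
    have "H x - H y \<le> h x * (y - x)" using assms that by (intro H_sandwich) auto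
    also have "\<dots> \<le> h \<delta> * (y - x)" using assms that by (intro mult_right_mono h_antimono) auto
    finally show ?thesis using H_antimono[of x y] assms that by auto
  qed
  fix x y assume "x \<in> {\<delta>..}" "y \<in> {\<delta>..}"
  then show "dist (H x) (H y) \<le> h \<delta> * dist x y"
    using le[of x y] le[of y x] by (cases "x \<le> y") (auto simp: dist_real_def abs_minus_commute)
qed (rule h_nonneg)

section \<open>Differentiability of \<open>H\<close> and \<open>Lam\<close> off the jumps of the
  weight\<close>

definition jumps :: "real set" where
  "jumps = {x. 0 < x \<and> \<not> isCont h x}"

lemma countable_jumps: "countable jumps"
proof -
  have "countable {x \<in> {0<..}. \<not> isCont (\<lambda>x. - h x) x}"
    by (rule mono_on_ctble_discont_open) (auto intro!: mono_onI h_antimono)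
  moreover have "isCont (\<lambda>x. - h x) x \<longleftrightarrow> isCont h x" for x
    using isCont_minus[of x h] isCont_minus[of x "\<lambda>x. - h x"] by auto
  ultimately show ?thesis by (simp add: jumps_def)
qed

text \<open>The difference quotient lies between \<open>- h x\<close> and \<open>- h y\<close>, so
  its error is at most \<open>\<bar>h y - h x\<bar>\<close>.\<close>

lemma H_deriv:
  assumes x: "0 < x" "x \<notin> jumps"
  shows "(H has_real_derivative - h x) (at x)"
proof -
  have "isCont h x" using x by (simp add: jumps_def)
  then have lim: "((\<lambda>y. \<bar>h y - h x\<bar>) \<longlongrightarrow> 0) (at x)"
    unfolding isCont_def by (intro tendsto_rabs_zero LIM_zero)
  have "eventually (\<lambda>y. y \<in> {0<..}) (nhds x)"
    using x(1) by (intro eventually_nhds_in_open) auto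
  then have "eventually (\<lambda>y. y > 0 \<and> y \<noteq> x) (at x)"
    unfolding eventually_at_filter by eventually_elim auto
  then have "eventually (\<lambda>y. norm ((H y - H x) / (y - x) - - h x) \<le> \<bar>h y - h x\<bar>) (at x)"
  proof eventually_elim
    case (elim y)
    show ?case
    proof (cases "x < y")
      case True
      then show ?thesis using H_sandwich[of x y] x(1) h_antimono[of x y]
        by (auto simp: abs_if field_simps)
    next
      case False
      then show ?thesis using H_sandwich[of y x] elim h_antimono[of y x]
        by (auto simp: abs_if field_simps)
    qed
  qed
  from Lim_null_comparison[OF this lim] show ?thesis
    unfolding has_field_derivative_iff by (rule LIM_zero_cancel)
qed

lemma Lam_nonpos: "Lam x \<le> 0"
  using H_nonneg[of x] by (simp add: Lam_def)

lemma mult_Lam: "0 < x \<Longrightarrow> x * Lam x = - H x"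
  by (simp add: Lam_def)

lemma abs_Lam_le:
  assumes "0 < \<delta>" "\<delta> \<le> x"
  shows "\<bar>Lam x\<bar> \<le> H \<delta> / \<delta>"
proof -
  have "\<bar>Lam x\<bar> = H x / x" using assms H_nonneg[of x] by (simp add: Lam_def)
  also have "\<dots> \<le> H \<delta> / \<delta>" using assms by (intro frac_le H_antimono H_nonneg) auto
  finally show ?thesis .
qed

text \<open>Differentiating \<open>x * Lam x = - H x\<close> gives
  \<open>Lam x + x * Lam' x = h x\<close>.\<close>

lemma Lam_deriv:
  assumes x: "0 < x" "x \<notin> jumps"
  shows "(Lam has_real_derivative (h x - Lam x) / x) (at x)"
proof -
  have "((\<lambda>x. - H x / x) has_real_derivative (h x - Lam x) / x) (at x)"
    using x by (auto intro!: derivative_eq_intros H_deriv simp: Lam_def field_simps)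
  then show ?thesis
    by (rule has_field_derivative_transform_within_open[where S="{0<..}"]) (use x in \<open>auto simp: Lam_def\<close>)
qed

lemma lipschitz_on_Lam:
  assumes d: "0 < \<delta>"
  shows "(h \<delta> / \<delta> + H \<delta> / \<delta>\<^sup>2)-lipschitz_on {\<delta>..} Lam"
proof (rule lipschitz_onI)
  fix x y assume xy: "x \<in> {\<delta>..}" "y \<in> {\<delta>..}"
  then have pos: "0 < x" "0 < y" using d by auto
  have "Lam x - Lam y = (H y - H x) / x + H y * ((x - y) / (x * y))"
    using pos by (simp add: Lam_def field_simps)
  also have "\<bar>\<dots>\<bar> \<le> \<bar>H y - H x\<bar> / x + H y * (\<bar>x - y\<bar> / (x * y))"
    using pos H_nonneg[of y] by (intro order_trans[OF abs_triangle_ineq]) (simp add: abs_mult)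
  also have "\<dots> \<le> h \<delta> * \<bar>x - y\<bar> / \<delta> + H \<delta> * (\<bar>x - y\<bar> / (\<delta> * \<delta>))"
  proof (intro add_mono frac_le mult_mono)
    show "\<bar>H y - H x\<bar> \<le> h \<delta> * \<bar>x - y\<bar>"
      using lipschitz_onD[OF lipschitz_on_H[OF d] xy] by (simp add: dist_real_def abs_minus_commute)
  qed (use xy d in \<open>auto intro: H_antimono H_nonneg h_nonneg mult_mono mult_nonneg_nonneg\<close>)
  also have "\<dots> = (h \<delta> / \<delta> + H \<delta> / \<delta>\<^sup>2) * \<bar>x - y\<bar>"
    by (simp add: power2_eq_square field_simps)
  finally show "dist (Lam x) (Lam y) \<le> (h \<delta> / \<delta> + H \<delta> / \<delta>\<^sup>2) * dist x y"
    by (simp add: dist_real_def)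
qed (use d h_nonneg H_nonneg in auto)

lemma continuous_on_Lam: "continuous_on {0<..} Lam"
proof (rule continuous_at_imp_continuous_on, rule ballI)
  fix x :: real assume x: "x \<in> {0<..}"
  have "continuous_on {x / 2<..} Lam"
    by (rule continuous_on_subset[OF lipschitz_on_continuous_on[OF lipschitz_on_Lam[of "x / 2"]]])
      (use x in auto)
  then show "isCont Lam x" using x by (auto simp: continuous_on_eq_continuous_at)
qed

lemma borel_measurable_Lam[measurable]: "Lam \<in> borel_measurable borel"
proof -
  have "Lam = (\<lambda>x. if x \<in> {0<..} then Lam x else 0)" by (auto simp: Lam_def)
  also have "\<dots> \<in> borel_measurable borel"
    by (rule borel_measurable_continuous_on_if) (auto intro: continuous_on_Lam)
  finally show ?thesis .
qed

text \<open>The integrand equals \<open>- H x\<close>, which is continuous even where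
  \<open>h\<close> jumps. The primitive is therefore classical, and composing it with the chord
  length needs no exceptional set for \<open>G\<close>.\<close>

lemma H_antiderivative:
  assumes "0 < a" "a < b"
  obtains G where "\<And>x. a < x \<Longrightarrow> x < b \<Longrightarrow> (G has_real_derivative x * Lam x) (at x)"
proof -
  have "continuous_on {a..b} (\<lambda>x. x * Lam x)"
    using assms by (intro continuous_intros continuous_on_subset[OF continuous_on_Lam]) auto
  from antiderivative_continuous[OF this] obtain G
    where G: "\<And>x. x \<in> {a..b} \<Longrightarrow> (G has_vector_derivative x * Lam x) (at x within {a..b})" by metis
  show ?thesis
    by (rule that[of G])
      (use G in \<open>auto simp: has_real_derivative_iff_has_vector_derivative at_within_Icc_at dest!: spec\<close>,
       metis atLeastAtMost_iff at_within_Icc_at less_imp_le)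
qed

text \<open>The distance from \<open>s\<close> rises to \<open>L / 2\<close> and falls again; the
  mirror map \<open>r \<mapsto> L - r\<close> folds the second half of the interval onto the first,
  whence the factor 2.\<close>

lemma integral_circle_dist:
  assumes "0 < \<epsilon>" "\<epsilon> \<le> L / 2"
  shows "(LINT t:{s + \<epsilon>..s + L - \<epsilon>}|lborel. h (circle_dist L s t)) = 2 * (H \<epsilon> - H (L / 2))"
proof -
  let ?m = "\<lambda>r. h (min r (L - r))"
  have int: "set_integrable lborel {\<epsilon>..L / 2} h"
    by (rule set_integrable_subset[OF h_tail[OF assms(1)]]) auto
  have mirror: "indicat_real {L / 2..L - \<epsilon>} (L + -1 * r) *\<^sub>R ?m (L + -1 * r) = indicat_real {\<epsilon>..L / 2} r *\<^sub>R h r" for r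
    using assms by (auto simp: indicator_def min_def intro!: arg_cong[where f=h])
  have int1: "set_integrable lborel {\<epsilon>..L / 2} ?m"
    by (rule set_integrable_cong[THEN iffD1, OF refl refl _ int]) (auto simp: min_def)
  have int2: "set_integrable lborel {L / 2..L - \<epsilon>} ?m"
    using int lborel_integrable_real_affine_iff[of "-1" "\<lambda>r. indicat_real {L / 2..L - \<epsilon>} r *\<^sub>R ?m r" L]
    unfolding set_integrable_def mirror by simp
  have "(LINT t:{s + \<epsilon>..s + L - \<epsilon>}|lborel. h (circle_dist L s t)) = (LINT r:{\<epsilon>..L - \<epsilon>}|lborel. ?m r)"
    unfolding set_lebesgue_integral_def
    by (subst lborel_integral_real_affine[where c=1 and t=s])
      (use assms in \<open>auto intro!: Bochner_Integration.integral_cong simp: indicator_def circle_dist_add\<close>)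
  also have "{\<epsilon>..L - \<epsilon>} = {\<epsilon>..L / 2} \<union> {L / 2..L - \<epsilon>}" using assms by auto
  also have "(LINT r:({\<epsilon>..L / 2} \<union> {L / 2..L - \<epsilon>})|lborel. ?m r) =
      (LINT r:{\<epsilon>..L / 2}|lborel. ?m r) + (LINT r:{L / 2..L - \<epsilon>}|lborel. ?m r)"
  proof (rule set_integral_Un_AE)
    show "AE t in lborel. \<not> (t \<in> {\<epsilon>..L / 2} \<and> t \<in> {L / 2..L - \<epsilon>})"
      using AE_lborel_singleton[of "L / 2"] by eventually_elim auto
  qed (use int1 int2 in auto)
  also have "(LINT r:{L / 2..L - \<epsilon>}|lborel. ?m r) = (LINT r:{\<epsilon>..L / 2}|lborel. h r)"
    using lborel_integral_real_affine[of "-1" "\<lambda>r. indicat_real {L / 2..L - \<epsilon>} r *\<^sub>R ?m r" L]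
    unfolding set_lebesgue_integral_def mirror by simp
  also have "(LINT r:{\<epsilon>..L / 2}|lborel. ?m r) = (LINT r:{\<epsilon>..L / 2}|lborel. h r)"
    by (rule set_lebesgue_integral_cong) (auto simp: min_def)
  finally show ?thesis using H_diff[of \<epsilon> "L / 2"] assms by simp
qed

end

section \<open>Closed curves\<close>

text \<open>The tangent is carried as a separate Borel field whose norm is at most 1 everywhere and
  equal to 1 almost everywhere, so that bounds hold without exceptional sets. Only the lower
  bi-Lipschitz bound is assumed; the upper one follows with constant 1.\<close>

locale closed_curve =
  fixes L c :: real and f T :: "real \<Rightarrow> 'a::euclidean_space"
  assumes L_pos: "0 < L" and c_pos: "0 < c"
    and f_add_period: "\<And>s. f (s + L) = f s" and T_add_period: "\<And>s. T (s + L) = T s"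
    and T_borel[measurable]: "T \<in> borel_measurable borel"
    and f_lipschitz: "\<exists>K. K-lipschitz_on UNIV f"
    and f_deriv: "AE s in lborel. (f has_vector_derivative T s) (at s)"
    and T_unit: "AE s in lborel. norm (T s) = 1"
    and T_le_1: "\<And>s. norm (T s) \<le> 1"
    and chord_ge: "\<And>s t. c * circle_dist L s t \<le> norm (f s - f t)"
begin

lemma f_integral:
  assumes "a \<le> b"
  shows "set_integrable lborel {a..b} T" "(LINT x:{a..b}|lborel. T x) = f b - f a"
proof -
  obtain K where K: "K-lipschitz_on UNIV f" using f_lipschitz by blast
  have "AE x in lborel. a < x \<longrightarrow> x < b \<longrightarrow> (f has_vector_derivative T x) (at x)"
    using f_deriv by eventually_elim auto
  from integral_vector_derivative_lipschitz[OF assms lipschitz_on_subset[OF K] T_borel this]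
  show "set_integrable lborel {a..b} T" "(LINT x:{a..b}|lborel. T x) = f b - f a" by auto
qed

text \<open>Integrating \<open>T\<close>, whose norm is at most 1, improves the unspecified
  Lipschitz constant to 1. This makes a chord no longer than the arc it spans.\<close>

lemma f_dist_le: "norm (f s - f t) \<le> \<bar>s - t\<bar>"
proof -
  have "norm (f b - f a) \<le> b - a" if "a \<le> b" for a b
  proof -
    have int: "integrable lborel (indicat_real {a..b})" using that by simp
    have "norm (f b - f a) = norm (\<integral>x. indicator {a..b} x *\<^sub>R T x \<partial>lborel)"
      using f_integral(2)[OF that] by (simp add: set_lebesgue_integral_def)
    also have "\<dots> \<le> (\<integral>x. indicat_real {a..b} x \<partial>lborel)"
      by (rule Bochner_Integration.integral_norm_bound_integral)
        (use f_integral(1)[OF that] int T_le_1 in \<open>auto simp: set_integrable_def split: split_indicator\<close>)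
    finally show ?thesis using that by simp
  qed
  from this[of s t] this[of t s] show ?thesis by (cases "s \<le> t") (auto simp: norm_minus_commute)
qed

lemma lipschitz_on_f: "1-lipschitz_on S f"
  by (rule lipschitz_onI) (use f_dist_le in \<open>auto simp: dist_norm dist_real_def\<close>)

lemma f_borel[measurable]: "f \<in> borel_measurable borel"
  by (rule borel_measurable_continuous_onI[OF lipschitz_on_continuous_on[OF lipschitz_on_f]])

lemma f_add_int_period: "f (s + of_int k * L) = f s"
proof (induction k rule: int_induct[where k=0])
  case (step1 i)
  with f_add_period[of "s + of_int i * L"] show ?case by (simp add: algebra_simps)
next
  case (step2 i)
  with f_add_period[of "s + of_int (i - 1) * L"] show ?case by (simp add: algebra_simps)
qed simp

lemma chord_le: "norm (f s - f t) \<le> circle_dist L s t"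
  unfolding circle_dist_def
proof (rule cINF_greatest)
  fix k :: int
  show "norm (f s - f t) \<le> \<bar>s - t - of_int k * L\<bar>"
    using f_dist_le[of s "t + of_int k * L"] unfolding f_add_int_period by (simp add: algebra_simps)
qed simp

text \<open>The lower bound keeps \<open>h\<close> and \<open>Lam\<close> away from their possible
  singularity at 0; the upper bound \<open>L / 2\<close> puts chord lengths into the range of
  \<open>cond_A5b\<close>.\<close>

lemma chord_bounds:
  assumes "0 < \<epsilon>" "s + \<epsilon> \<le> t" "t \<le> s + L - \<epsilon>"
  shows "c * \<epsilon> \<le> norm (f s - f t)" "norm (f s - f t) \<le> L / 2"
    "norm (f s - f t) \<le> circle_dist L s t" "0 < c * \<epsilon>"
proof -
  have "circle_dist L s (s + (t - s)) = min (t - s) (L - (t - s))"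
    using assms by (intro circle_dist_add) auto
  then have d: "circle_dist L s t = min (t - s) (L - (t - s))" by simp
  have "c * \<epsilon> \<le> c * circle_dist L s t" using assms c_pos by (intro mult_left_mono) (auto simp: d)
  then show "c * \<epsilon> \<le> norm (f s - f t)" using chord_ge[of s t] by linarith
  show "norm (f s - f t) \<le> L / 2" using chord_le[of s t] unfolding d by (auto simp: min_def split: if_splits)
  show "norm (f s - f t) \<le> circle_dist L s t" by (rule chord_le)
qed (use assms c_pos in auto)

lemma inner_T_le: "\<bar>x \<bullet> T s\<bar> \<le> norm x"
  using Cauchy_Schwarz_ineq2[of x "T s"] T_le_1[of s] mult_left_le[of "norm (T s)" "norm x"]
  by simp

lemma T_inner_T_le: "\<bar>T s \<bullet> T t\<bar> \<le> 1"
  using inner_T_le[of "T s" t] T_le_1[of s] by linarith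

end

section \<open>Integration by parts\<close>

locale weighted_curve = closed_curve L c f T + decreasing_weight h
  for L c and f T :: "real \<Rightarrow> 'a::euclidean_space" and h
begin

text \<open>This is \<open>- \<partial>\<^sub>s \<partial>\<^sub>t G(\<parallel>f s - f t\<parallel>)\<close> for a primitive \<open>G\<close> of \<open>\<lambda>x. x * Lam x\<close>; note that \<open>(x * Lam x)' = h x\<close>.\<close>
definition mixed_density :: "real \<Rightarrow> real \<Rightarrow> real" where
  "mixed_density s t = Lam (norm (f s - f t)) * (T s \<bullet> T t) +
     (h (norm (f s - f t)) - Lam (norm (f s - f t))) *
       (((f s - f t) \<bullet> T s) * ((f s - f t) \<bullet> T t) / (norm (f s - f t))\<^sup>2)"

lemma borel_measurable_mixed_density[measurable]:
  assumes [measurable]: "u \<in> borel_measurable M" "v \<in> borel_measurable M"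
  shows "(\<lambda>x. mixed_density (u x) (v x)) \<in> borel_measurable M"
  unfolding mixed_density_def by measurable

text \<open>The fundamental theorem in \<open>t\<close> alone. The primitive \<open>F\<close> below
  is minus the \<open>s\<close>-derivative of \<open>G\<close> at the chord length, written out with
  \<open>T s\<close>; as \<open>s\<close> is fixed, no derivative of the tangent occurs.\<close>

lemma integral_mixed_density:
  assumes eps: "0 < \<epsilon>" "\<epsilon> \<le> L / 2"
  shows "(LINT t:{s + \<epsilon>..s + L - \<epsilon>}|lborel. mixed_density s t) =
    Lam (norm (f s - f (s + \<epsilon>))) * ((f s - f (s + \<epsilon>)) \<bullet> T s) -
    Lam (norm (f s - f (s + L - \<epsilon>))) * ((f s - f (s + L - \<epsilon>)) \<bullet> T s)"
proof -
  define \<delta> where "\<delta> = c * \<epsilon>"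
  have d: "0 < \<delta>" using eps c_pos by (simp add: \<delta>_def)
  define D where "D t = norm (f s - f t)" for t
  define F where "F t = Lam (D t) * ((f t - f s) \<bullet> T s)" for t
  let ?I = "{s + \<epsilon>..s + L - \<epsilon>}"
  have D: "D t \<in> {\<delta>..}" "D t \<le> L / 2" if "t \<in> ?I" for t
    using chord_bounds[of \<epsilon> s t] that eps by (auto simp: D_def \<delta>_def)
  have D_lip: "1-lipschitz_on ?I D"
  proof (rule lipschitz_onI)
    fix x y
    have "\<bar>D x - D y\<bar> \<le> norm (f x - f y)"
      using norm_triangle_ineq3[of "f s - f x" "f s - f y"] by (simp add: D_def norm_minus_commute)
    then show "dist (D x) (D y) \<le> 1 * dist x y"
      using f_dist_le[of x y] by (simp add: dist_real_def)
  qed simp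
  obtain K where K: "K-lipschitz_on {\<delta>..} Lam" using lipschitz_on_Lam[OF d] by blast
  have "D ` ?I \<subseteq> {\<delta>..}" using D(1) by auto
  from lipschitz_on_compose2[OF D_lip lipschitz_on_subset[OF K this]]
  have "(K * 1)-lipschitz_on ?I (\<lambda>t. Lam (D t))" by simp
  moreover have "1-lipschitz_on ?I (\<lambda>t. (f t - f s) \<bullet> T s)"
  proof (rule lipschitz_onI)
    fix x y
    show "dist ((f x - f s) \<bullet> T s) ((f y - f s) \<bullet> T s) \<le> 1 * dist x y"
      using inner_T_le[of "f x - f y" s] f_dist_le[of x y] by (simp add: dist_real_def inner_diff_left)
  qed simp
  moreover have "\<bar>(f t - f s) \<bullet> T s\<bar> \<le> L / 2" if "t \<in> ?I" for t
    using inner_T_le[of "f t - f s" s] D(2)[OF that] by (simp add: D_def norm_minus_commute)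
  moreover have "\<bar>Lam (D t)\<bar> \<le> H \<delta> / \<delta>" if "t \<in> ?I" for t
    using abs_Lam_le[OF d, of "D t"] D(1)[OF that] by auto
  ultimately have "((K * 1) * (L / 2) + (H \<delta> / \<delta>) * 1)-lipschitz_on ?I F"
    unfolding F_def using L_pos d H_nonneg by (intro lipschitz_on_mult_bounded) auto
  moreover have "AE t in lborel. s + \<epsilon> < t \<longrightarrow> t < s + L - \<epsilon> \<longrightarrow> (F has_vector_derivative mixed_density s t) (at t)"
  proof -
    \<comment> \<open>The chain rule wants an open domain, whereas the chord lengths range over a
      subset of the closed half-line from \<open>\<delta>\<close>; halving \<open>\<delta>\<close>
      gives the room.\<close>
    have "K-lipschitz_on {\<delta> / 2<..} Lam" if "K-lipschitz_on {\<delta> / 2..} Lam" for K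
      using that by (rule lipschitz_on_subset) auto
    then obtain K' where K': "K'-lipschitz_on {\<delta> / 2<..} Lam"
      using lipschitz_on_Lam[of "\<delta> / 2"] d by auto
    have "AE t in lborel. \<forall>d. D t \<in> {\<delta> / 2<..} \<longrightarrow> (D has_real_derivative d) (at t) \<longrightarrow>
           ((\<lambda>t. Lam (D t)) has_real_derivative (h (D t) - Lam (D t)) / D t * d) (at t)"
      by (rule AE_chain_rule_lipschitz[OF _ K' countable_jumps]) (use d in \<open>auto intro!: Lam_deriv\<close>)
    with f_deriv show ?thesis
    proof eventually_elim
      case (elim t)
      show ?case
      proof (intro impI)
        assume t: "s + \<epsilon> < t" "t < s + L - \<epsilon>"
        then have Dt: "\<delta> \<le> D t" "0 < D t" using D(1)[of t] d by auto
        have fd: "((\<lambda>t. f s - f t) has_vector_derivative - T t) (at t)"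
          using has_vector_derivative_diff[OF has_vector_derivative_const elim(1)] by simp
        have "(D has_real_derivative ((f s - f t) \<bullet> (- T t)) / D t) (at t)"
          unfolding D_def using Dt by (intro has_real_derivative_norm fd) (auto simp: D_def)
        with elim(2) Dt d have 1: "((\<lambda>t. Lam (D t)) has_real_derivative
            (h (D t) - Lam (D t)) / D t * (((f s - f t) \<bullet> (- T t)) / D t)) (at t)"
          by auto
        have fd': "((\<lambda>t. f t - f s) has_vector_derivative T t) (at t)"
          using has_vector_derivative_diff[OF elim(1) has_vector_derivative_const] by simp
        have 2: "((\<lambda>t. (f t - f s) \<bullet> T s) has_real_derivative T t \<bullet> T s) (at t)"
          using has_real_derivative_inner[OF fd' has_vector_derivative_const] by simp
        have flip: "(f t - f s) \<bullet> T s = - ((f s - f t) \<bullet> T s)" by (simp add: inner_diff_left)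
        have "(F has_real_derivative mixed_density s t) (at t)"
          unfolding F_def
          by (rule DERIV_cong[OF DERIV_mult[OF 1 2]])
            (use Dt in \<open>simp add: mixed_density_def D_def[symmetric] flip power2_eq_square inner_commute[of "T t"] field_simps\<close>)
        then show "(F has_vector_derivative mixed_density s t) (at t)"
          by (simp add: has_real_derivative_iff_has_vector_derivative)
      qed
    qed
  qed
  moreover have "mixed_density s \<in> borel_measurable borel" unfolding mixed_density_def by measurable
  ultimately have "(LINT t:?I|lborel. mixed_density s t) = F (s + L - \<epsilon>) - F (s + \<epsilon>)"
    using eps by (intro integral_vector_derivative_lipschitz) auto
  then show ?thesis by (simp add: F_def D_def inner_diff_left algebra_simps)
qed

section \<open>The two boundary terms\<close>

definition left_boundary :: "real \<Rightarrow> real \<Rightarrow> real" where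
  "left_boundary \<epsilon> s = Lam (norm (f s - f (s + \<epsilon>))) * ((f (s + \<epsilon>) - f s) \<bullet> T s)"

text \<open>The boundary value at \<open>t = s + L - \<epsilon>\<close> is minus this function at
  \<open>s + (L - \<epsilon>)\<close>: modulo the period, the chord then runs from
  \<open>s - \<epsilon>\<close> to \<open>s\<close> and is tested against the tangent at its far
  end.\<close>

definition right_boundary :: "real \<Rightarrow> real \<Rightarrow> real" where
  "right_boundary \<epsilon> s = Lam (norm (f s - f (s + \<epsilon>))) * ((f (s + \<epsilon>) - f s) \<bullet> T (s + \<epsilon>))"

lemma left_boundary_borel[measurable]: "left_boundary \<epsilon> \<in> borel_measurable borel"
  and right_boundary_borel[measurable]: "right_boundary \<epsilon> \<in> borel_measurable borel"
  unfolding left_boundary_def[abs_def] right_boundary_def[abs_def] by measurable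

lemma right_boundary_add_period: "right_boundary \<epsilon> (s + L) = right_boundary \<epsilon> s"
proof -
  have "f (s + L + \<epsilon>) = f (s + \<epsilon>)" "T (s + L + \<epsilon>) = T (s + \<epsilon>)"
    using f_add_period[of "s + \<epsilon>"] T_add_period[of "s + \<epsilon>"] by (simp_all add: algebra_simps)
  then show ?thesis by (simp add: right_boundary_def f_add_period)
qed

lemma integrable_period_bounded:
  fixes g :: "real \<Rightarrow> real"
  assumes [measurable]: "g \<in> borel_measurable borel" and "\<And>s. \<bar>g s\<bar> \<le> B"
  shows "set_integrable lborel {0..<L} g"
  unfolding set_integrable_def
  by (rule integrableI_bounded_set[where A="{0..<L}" and B=B]) (use assms L_pos in auto)

lemma Lam_chord_bound:
  assumes eps: "0 < \<epsilon>" "\<epsilon> \<le> L / 2"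
  shows "\<bar>Lam (norm (f s - f (s + \<epsilon>)))\<bar> \<le> H (c * \<epsilon>) / (c * \<epsilon>)"
  using chord_bounds[of \<epsilon> s "s + \<epsilon>"] eps by (intro abs_Lam_le) auto

lemma boundary_bounded:
  assumes eps: "0 < \<epsilon>" "\<epsilon> \<le> L / 2"
  shows "\<bar>left_boundary \<epsilon> s\<bar> \<le> H (c * \<epsilon>) / (c * \<epsilon>) * (L / 2)" "\<bar>right_boundary \<epsilon> s\<bar> \<le> H (c * \<epsilon>) / (c * \<epsilon>) * (L / 2)"
  unfolding left_boundary_def right_boundary_def abs_mult
proof -
  have "\<bar>(f (s + \<epsilon>) - f s) \<bullet> T r\<bar> \<le> L / 2" for r
    using chord_bounds(2)[of \<epsilon> s "s + \<epsilon>"] eps inner_T_le[of "f (s + \<epsilon>) - f s" r]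
    by (simp add: norm_minus_commute)
  then show "\<bar>Lam (norm (f s - f (s + \<epsilon>)))\<bar> * \<bar>(f (s + \<epsilon>) - f s) \<bullet> T s\<bar> \<le> H (c * \<epsilon>) / (c * \<epsilon>) * (L / 2)"
    "\<bar>Lam (norm (f s - f (s + \<epsilon>)))\<bar> * \<bar>(f (s + \<epsilon>) - f s) \<bullet> T (s + \<epsilon>)\<bar> \<le> H (c * \<epsilon>) / (c * \<epsilon>) * (L / 2)"
    using Lam_chord_bound[OF eps, of s] H_nonneg eps c_pos by (auto intro!: mult_mono simp del: times_divide_eq_left times_divide_eq_right)
qed

lemma set_integrable_boundary:
  assumes eps: "0 < \<epsilon>" "\<epsilon> \<le> L / 2"
  shows "set_integrable lborel {0..<L} (left_boundary \<epsilon>)" "set_integrable lborel {0..<L} (right_boundary \<epsilon>)"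
  by (intro integrable_period_bounded[OF _ boundary_bounded(1)[OF eps]] integrable_period_bounded[OF _ boundary_bounded(2)[OF eps]]; simp)+

text \<open>\<open>right_boundary - left_boundary\<close> is the derivative of a function of the chord length \<open>\<parallel>f (s + \<epsilon>) - f s\<parallel>\<close>, which is periodic.\<close>
lemma integral_right_boundary_eq_left:
  assumes eps: "0 < \<epsilon>" "\<epsilon> \<le> L / 2"
  shows "(LINT s:{0..<L}|lborel. right_boundary \<epsilon> s) = (LINT s:{0..<L}|lborel. left_boundary \<epsilon> s)"
proof -
  define \<delta> where "\<delta> = c * \<epsilon>"
  have d: "0 < \<delta>" using eps c_pos by (simp add: \<delta>_def)
  define D where "D s = norm (f s - f (s + \<epsilon>))" for s
  have D: "\<delta> \<le> D s" "D s \<le> L / 2" for s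
    using chord_bounds[of \<epsilon> s "s + \<epsilon>"] eps by (auto simp: D_def \<delta>_def)
  \<comment> \<open>Chord lengths lie in \<open>[\<delta>, L / 2]\<close>. The primitive is taken on
    the larger interval from \<open>\<delta> / 2\<close> to \<open>L\<close>, so that it is
    differentiable at both extreme lengths.\<close>
  have dL: "\<delta> / 2 < L" using D[of 0] d L_pos by linarith
  obtain G where G: "\<And>x. \<delta> / 2 < x \<Longrightarrow> x < L \<Longrightarrow> (G has_real_derivative x * Lam x) (at x)"
    using H_antiderivative[of "\<delta> / 2" L] d dL by auto
  have G_bound: "norm (G x - G y) \<le> H \<delta> * norm (x - y)" if "x \<in> {\<delta>..L / 2}" "y \<in> {\<delta>..L / 2}" for x y
  proof (rule field_differentiable_bound[OF convex_closed_interval _ _ that])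
    fix z assume z: "z \<in> {\<delta>..L / 2}"
    then show "(G has_real_derivative z * Lam z) (at z within {\<delta>..L / 2})"
      using d L_pos by (auto intro!: has_field_derivative_at_within[OF G])
    show "norm (z * Lam z) \<le> H \<delta>"
      using z d H_nonneg[of z] H_antimono[of \<delta> z] by (simp add: mult_Lam)
  qed
  have D_lip: "\<bar>D x - D y\<bar> \<le> 2 * \<bar>x - y\<bar>" for x y
  proof -
    have "\<bar>D x - D y\<bar> \<le> norm ((f x - f y) - (f (x + \<epsilon>) - f (y + \<epsilon>)))"
      using norm_triangle_ineq3[of "f x - f (x + \<epsilon>)" "f y - f (y + \<epsilon>)"] by (simp add: D_def algebra_simps)
    also have "\<dots> \<le> norm (f x - f y) + norm (f (x + \<epsilon>) - f (y + \<epsilon>))" by (rule norm_triangle_ineq4)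
    finally show ?thesis using f_dist_le[of x y] f_dist_le[of "x + \<epsilon>" "y + \<epsilon>"] by simp
  qed
  have lip: "(H \<delta> * 2)-lipschitz_on {0..L} (\<lambda>s. G (D s))"
  proof (rule lipschitz_onI)
    fix x y
    have "\<bar>G (D x) - G (D y)\<bar> \<le> H \<delta> * \<bar>D x - D y\<bar>" using G_bound[of "D x" "D y"] D by auto
    also have "\<dots> \<le> H \<delta> * (2 * \<bar>x - y\<bar>)" by (intro mult_left_mono D_lip H_nonneg)
    finally show "dist (G (D x)) (G (D y)) \<le> H \<delta> * 2 * dist x y" by (simp add: dist_real_def)
  qed (simp add: H_nonneg)
  have deriv: "AE s in lborel. 0 < s \<longrightarrow> s < L \<longrightarrow> ((\<lambda>s. G (D s)) has_vector_derivative right_boundary \<epsilon> s - left_boundary \<epsilon> s) (at s)"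
    using f_deriv AE_lborel_shift[OF f_deriv, of \<epsilon>]
  proof eventually_elim
    case (elim s)
    have Ds: "0 < D s" using D(1)[of s] d by simp
    have "((\<lambda>s. f (s + \<epsilon>)) has_vector_derivative T (s + \<epsilon>)) (at s)"
      using elim(2) unfolding has_vector_derivative_iff_tendsto by (simp add: add.assoc add.commute[of \<epsilon>])
    from has_vector_derivative_diff[OF elim(1) this]
    have "(D has_real_derivative ((f s - f (s + \<epsilon>)) \<bullet> (T s - T (s + \<epsilon>))) / D s) (at s)"
      unfolding D_def using Ds by (intro has_real_derivative_norm) (auto simp: D_def)
    from DERIV_chain2[OF G this] D[of s] d L_pos
    have "((\<lambda>s. G (D s)) has_real_derivative
        D s * Lam (D s) * (((f s - f (s + \<epsilon>)) \<bullet> (T s - T (s + \<epsilon>))) / D s)) (at s)" by simp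
    also have "D s * Lam (D s) * (((f s - f (s + \<epsilon>)) \<bullet> (T s - T (s + \<epsilon>))) / D s) = right_boundary \<epsilon> s - left_boundary \<epsilon> s"
      using Ds unfolding left_boundary_def right_boundary_def D_def[symmetric]
      by (simp add: inner_diff_left inner_diff_right field_simps)
    finally show ?case by (simp add: has_real_derivative_iff_has_vector_derivative)
  qed
  have meas: "(\<lambda>s. right_boundary \<epsilon> s - left_boundary \<epsilon> s) \<in> borel_measurable borel" by measurable
  have "(LINT s:{0..L}|lborel. right_boundary \<epsilon> s - left_boundary \<epsilon> s) = G (D L) - G (D 0)"
    using L_pos by (intro integral_vector_derivative_lipschitz(2)[OF _ lip meas deriv]) auto
  also have "D L = D 0" using f_add_period[of 0] f_add_period[of \<epsilon>] by (simp add: D_def add.commute)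
  finally have "(LINT s:{0..L}|lborel. right_boundary \<epsilon> s - left_boundary \<epsilon> s) = 0" by simp
  moreover have "(LINT s:{0..L}|lborel. right_boundary \<epsilon> s - left_boundary \<epsilon> s) = (LINT s:{0..<L}|lborel. right_boundary \<epsilon> s - left_boundary \<epsilon> s)"
    unfolding set_lebesgue_integral_def
  proof (rule integral_cong_AE)
    show "AE s in lborel. indicator {0..L} s *\<^sub>R (right_boundary \<epsilon> s - left_boundary \<epsilon> s) = indicator {0..<L} s *\<^sub>R (right_boundary \<epsilon> s - left_boundary \<epsilon> s)"
      using AE_lborel_singleton[of L] by eventually_elim (auto simp: indicator_def)
  qed measurable
  ultimately show ?thesis
    using set_integral_diff(2)[OF set_integrable_boundary(2,1)[OF eps]] by simp
qed

text \<open>The upper end contributes \<open>right_boundary\<close> at a translated parameter.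
  Periodicity removes the translation from the integral, and then both ends contribute equally,
  whence the factor 2.\<close>

lemma integral_integral_mixed_density:
  assumes eps: "0 < \<epsilon>" "\<epsilon> \<le> L / 2"
  shows "(LINT s:{0..<L}|lborel. (LINT t:{s + \<epsilon>..s + L - \<epsilon>}|lborel. mixed_density s t)) =
    - 2 * (LINT s:{0..<L}|lborel. left_boundary \<epsilon> s)"
proof -
  have "(LINT t:{s + \<epsilon>..s + L - \<epsilon>}|lborel. mixed_density s t) = - left_boundary \<epsilon> s - right_boundary \<epsilon> (s + (L - \<epsilon>))" for s
  proof -
    have "s + (L - \<epsilon>) + \<epsilon> = s + L" "s + (L - \<epsilon>) = s + L - \<epsilon>" by simp_all
    then have "right_boundary \<epsilon> (s + (L - \<epsilon>)) =
        Lam (norm (f s - f (s + L - \<epsilon>))) * ((f s - f (s + L - \<epsilon>)) \<bullet> T s)"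
      unfolding right_boundary_def by (simp only: f_add_period T_add_period norm_minus_commute)
    moreover have "(f s - f (s + \<epsilon>)) \<bullet> T s = - ((f (s + \<epsilon>) - f s) \<bullet> T s)"
      by (simp add: inner_diff_left)
    ultimately show ?thesis unfolding integral_mixed_density[OF eps] left_boundary_def by simp
  qed
  then have "(LINT s:{0..<L}|lborel. (LINT t:{s + \<epsilon>..s + L - \<epsilon>}|lborel. mixed_density s t)) =
      (LINT s:{0..<L}|lborel. - left_boundary \<epsilon> s - right_boundary \<epsilon> (s + (L - \<epsilon>)))" by simp
  also have "\<dots> = (LINT s:{0..<L}|lborel. - left_boundary \<epsilon> s) - (LINT s:{0..<L}|lborel. right_boundary \<epsilon> (s + (L - \<epsilon>)))"
  proof (rule set_integral_diff(2))
    show "set_integrable lborel {0..<L} (\<lambda>s. - left_boundary \<epsilon> s)"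
      using set_integrable_boundary(1)[OF eps] by (simp add: set_integrable_def)
    show "set_integrable lborel {0..<L} (\<lambda>s. right_boundary \<epsilon> (s + (L - \<epsilon>)))"
      by (rule integrable_period_bounded[OF _ boundary_bounded(2)[OF eps]]) measurable
  qed
  also have "(LINT s:{0..<L}|lborel. right_boundary \<epsilon> (s + (L - \<epsilon>))) = (LINT s:{0..<L}|lborel. right_boundary \<epsilon> s)"
    by (rule integral_periodic_shift) (use set_integrable_boundary(2)[OF eps] eps L_pos in \<open>auto simp: right_boundary_add_period\<close>)
  finally show ?thesis using integral_right_boundary_eq_left[OF eps] by (simp add: set_lebesgue_integral_def)
qed

text \<open>The boundary term of the integration by parts, in the form that condition (A.4) controls:
  \<open>(f (s + \<epsilon>) - f s) \<bullet> T s = \<integral> T t \<bullet> T s = \<epsilon> - 1/2 \<integral> \<parallel>T s - T t\<parallel>\<^sup>2\<close> over \<open>t \<in> [s, s + \<epsilon>]\<close>.\<close>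
lemma integral_left_boundary:
  assumes eps: "0 < \<epsilon>" "\<epsilon> \<le> L / 2"
  shows "(LINT s:{0..<L}|lborel. left_boundary \<epsilon> s) - L * \<epsilon> * Lam \<epsilon> =
    \<epsilon> * (LINT s:{0..<L}|lborel. Lam (norm (f s - f (s + \<epsilon>))) - Lam \<epsilon>) -
    1 / 2 * (LINT s:{0..<L}|lborel. Lam (norm (f s - f (s + \<epsilon>))) *
               (LINT t:{s..s + \<epsilon>}|lborel. (norm (T s - T t))\<^sup>2))"
proof -
  define W where "W s = (LINT t:{s..s + \<epsilon>}|lborel. (norm (T s - T t))\<^sup>2)" for s
  define l where "l s = Lam (norm (f s - f (s + \<epsilon>)))" for s
  have [measurable]: "W \<in> borel_measurable borel" "l \<in> borel_measurable borel"
    unfolding W_def l_def by (rule borel_measurable_oscillation, measurable)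
  have T_diff: "(norm (T s - T t))\<^sup>2 \<le> 4" for s t
  proof -
    have "norm (T s - T t) \<le> 2" using norm_triangle_ineq4[of "T s" "T t"] T_le_1[of s] T_le_1[of t] by linarith
    then show ?thesis using power_mono[of "norm (T s - T t)" 2 2] by simp
  qed
  have W_int: "set_integrable lborel {s..s + \<epsilon>} (\<lambda>t. (norm (T s - T t))\<^sup>2)" for s
    unfolding set_integrable_def
    by (rule integrableI_bounded_set[where A="{s..s + \<epsilon>}" and B=4]) (use T_diff eps in auto)
  have W_bound: "\<bar>W s\<bar> \<le> 4 * \<epsilon>" for s
  proof -
    have "W s \<le> (LINT t:{s..s + \<epsilon>}|lborel. 4)"
      unfolding W_def by (rule set_integral_mono[OF W_int])
        (use T_diff eps in \<open>auto simp: set_integrable_def\<close>)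
    moreover have "0 \<le> W s" unfolding W_def set_lebesgue_integral_def by simp
    ultimately show ?thesis using eps by (simp add: set_lebesgue_integral_def)
  qed
  have inner_eq: "(f (s + \<epsilon>) - f s) \<bullet> T s = \<epsilon> - 1 / 2 * W s" if s: "norm (T s) = 1" for s
  proof -
    have "(f (s + \<epsilon>) - f s) \<bullet> T s = (\<integral>t. indicator {s..s + \<epsilon>} t *\<^sub>R T t \<partial>lborel) \<bullet> T s"
      using f_integral(2)[of s "s + \<epsilon>"] eps by (simp add: set_lebesgue_integral_def)
    also have "\<dots> = (\<integral>t. (indicator {s..s + \<epsilon>} t *\<^sub>R T t) \<bullet> T s \<partial>lborel)"
      using f_integral(1)[of s "s + \<epsilon>"] eps by (intro integral_inner_left[symmetric]) (auto simp: set_integrable_def)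
    also have "\<dots> = (\<integral>t. indicator {s..s + \<epsilon>} t - 1 / 2 * (indicator {s..s + \<epsilon>} t *\<^sub>R (norm (T s - T t))\<^sup>2) \<partial>lborel)"
    proof (rule integral_cong_AE)
      show "AE t in lborel. (indicator {s..s + \<epsilon>} t *\<^sub>R T t) \<bullet> T s =
          indicator {s..s + \<epsilon>} t - 1 / 2 * (indicator {s..s + \<epsilon>} t *\<^sub>R (norm (T s - T t))\<^sup>2)"
        using T_unit
      proof eventually_elim
        case (elim t)
        have "(norm (T s - T t))\<^sup>2 = 2 - 2 * (T t \<bullet> T s)"
          using s elim by (simp add: power2_norm_eq_inner inner_diff_left inner_diff_right inner_commute norm_eq_1)
        then show ?case by (simp add: indicator_def field_simps)
      qed
    qed measurable
    also have "\<dots> = \<epsilon> - 1 / 2 * W s"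
      using W_int[of s] eps unfolding W_def set_lebesgue_integral_def set_integrable_def
      by (subst Bochner_Integration.integral_diff) auto
    finally show ?thesis .
  qed
  have l_bound: "\<bar>l s\<bar> \<le> H (c * \<epsilon>) / (c * \<epsilon>)" for s unfolding l_def by (rule Lam_chord_bound[OF eps])
  have l_int: "set_integrable lborel {0..<L} l" by (rule integrable_period_bounded[OF _ l_bound]) measurable
  have lW_int: "set_integrable lborel {0..<L} (\<lambda>s. l s * W s)"
  proof (rule integrable_period_bounded)
    fix s show "\<bar>l s * W s\<bar> \<le> H (c * \<epsilon>) / (c * \<epsilon>) * (4 * \<epsilon>)"
      unfolding abs_mult using l_bound W_bound eps H_nonneg c_pos by (intro mult_mono) auto
  qed measurable
  have "(LINT s:{0..<L}|lborel. left_boundary \<epsilon> s) = (LINT s:{0..<L}|lborel. \<epsilon> * l s - 1 / 2 * (l s * W s))"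
  proof -
    have "AE s in lborel. left_boundary \<epsilon> s = \<epsilon> * l s - 1 / 2 * (l s * W s)"
      using T_unit by eventually_elim (simp add: left_boundary_def l_def inner_eq right_diff_distrib)
    then have "AE s in lborel. indicator {0..<L} s *\<^sub>R left_boundary \<epsilon> s =
        indicator {0..<L} s *\<^sub>R (\<epsilon> * l s - 1 / 2 * (l s * W s))"
      by eventually_elim simp
    then show ?thesis unfolding set_lebesgue_integral_def
      by (rule integral_cong_AE[rotated 2]) measurable
  qed
  also have "\<dots> = \<epsilon> * (LINT s:{0..<L}|lborel. l s) - 1 / 2 * (LINT s:{0..<L}|lborel. l s * W s)"
    using l_int lW_int by (subst set_integral_diff(2)) auto
  also have "(LINT s:{0..<L}|lborel. l s) = (LINT s:{0..<L}|lborel. l s - Lam \<epsilon>) + L * Lam \<epsilon>"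
    using l_int L_pos by (subst set_integral_diff(2)) (auto simp: set_integrable_def set_lebesgue_integral_def)
  finally show ?thesis by (simp add: l_def W_def algebra_simps)
qed

end

section \<open>Decomposition of the energy\<close>

context weighted_curve
begin

text \<open>An oblique fundamental domain: \<open>t\<close> runs over one period starting at
  \<open>s\<close>, so both copies of the diagonal lie on its boundary and removing a neighbourhood
  of them leaves a single interval of \<open>t\<close> for each \<open>s\<close>.\<close>

definition off_diag_gap :: "real \<Rightarrow> (real \<times> real) set" where
  "off_diag_gap \<epsilon> = {p. 0 \<le> fst p \<and> fst p < L \<and> fst p + \<epsilon> \<le> snd p \<and> snd p \<le> fst p + L - \<epsilon>}"

definition off_diag :: "(real \<times> real) set" where
  "off_diag = {p. 0 \<le> fst p \<and> fst p < L \<and> fst p < snd p \<and> snd p < fst p + L}"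

lemma off_diag_gap_sets[measurable]: "off_diag_gap \<epsilon> \<in> sets (lborel \<Otimes>\<^sub>M lborel)" "off_diag \<in> sets (lborel \<Otimes>\<^sub>M lborel)"
proof -
  have "{p \<in> space (lborel \<Otimes>\<^sub>M lborel). 0 \<le> fst p \<and> fst p < L \<and> fst p + \<epsilon> \<le> snd p \<and> snd p \<le> fst p + L - \<epsilon>}
      \<in> sets (lborel \<Otimes>\<^sub>M lborel)" by measurable
  then show "off_diag_gap \<epsilon> \<in> sets (lborel \<Otimes>\<^sub>M lborel)" by (simp add: off_diag_gap_def space_pair_measure)
  have "{p \<in> space (lborel \<Otimes>\<^sub>M lborel). 0 \<le> fst p \<and> fst p < L \<and> fst p < snd p \<and> snd p < fst p + L}
      \<in> sets (lborel \<Otimes>\<^sub>M lborel)" by measurable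
  then show "off_diag \<in> sets (lborel \<Otimes>\<^sub>M lborel)" by (simp add: off_diag_def space_pair_measure)
qed

lemma emeasure_off_diag_gap:
  assumes "0 < \<epsilon>"
  shows "emeasure (lborel \<Otimes>\<^sub>M lborel) (off_diag_gap \<epsilon>) < \<infinity>"
proof -
  have "emeasure (lborel \<Otimes>\<^sub>M lborel) (off_diag_gap \<epsilon>) \<le> emeasure (lborel \<Otimes>\<^sub>M lborel) ({0..L} \<times> {0..2 * L})"
    by (rule emeasure_mono) (use assms in \<open>auto simp: off_diag_gap_def\<close>)
  also have "\<dots> = emeasure lborel {0..L} * emeasure lborel {0..2 * L}"
    by (rule lborel.emeasure_pair_measure_Times) auto
  also have "\<dots> < \<infinity>" using L_pos by (simp add: ennreal_mult_less_top)
  finally show ?thesis .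
qed

lemma integrable_off_diag_gap:
  fixes g :: "real \<Rightarrow> real \<Rightarrow> real"
  assumes [measurable]: "(\<lambda>p. g (fst p) (snd p)) \<in> borel_measurable (lborel \<Otimes>\<^sub>M lborel)"
    and "0 < \<epsilon>" and B: "\<And>s t. (s, t) \<in> off_diag_gap \<epsilon> \<Longrightarrow> \<bar>g s t\<bar> \<le> B"
  shows "set_integrable (lborel \<Otimes>\<^sub>M lborel) (off_diag_gap \<epsilon>) (\<lambda>p. g (fst p) (snd p))"
  unfolding set_integrable_def
  by (rule integrableI_bounded_set[where A="off_diag_gap \<epsilon>" and B=B])
    (use emeasure_off_diag_gap[OF assms(2)] B off_diag_gap_sets in auto)

lemma set_integral_off_diag_gap:
  fixes g :: "real \<Rightarrow> real \<Rightarrow> real"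
  assumes "set_integrable (lborel \<Otimes>\<^sub>M lborel) (off_diag_gap \<epsilon>) (\<lambda>p. g (fst p) (snd p))"
  shows "(LINT p:off_diag_gap \<epsilon>|lborel \<Otimes>\<^sub>M lborel. g (fst p) (snd p)) =
    (LINT s:{0..<L}|lborel. (LINT t:{s + \<epsilon>..s + L - \<epsilon>}|lborel. g s t))"
proof -
  have "(LINT p:off_diag_gap \<epsilon>|lborel \<Otimes>\<^sub>M lborel. g (fst p) (snd p)) =
      (\<integral>s. \<integral>t. indicator (off_diag_gap \<epsilon>) (s, t) *\<^sub>R g s t \<partial>lborel \<partial>lborel)"
    unfolding set_lebesgue_integral_def
    using lborel_pair.integral_fst'[OF assms[unfolded set_integrable_def]] by simp
  also have "\<dots> = (LINT s:{0..<L}|lborel. (LINT t:{s + \<epsilon>..s + L - \<epsilon>}|lborel. g s t))"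
    unfolding set_lebesgue_integral_def
  proof (intro Bochner_Integration.integral_cong refl)
    fix s
    show "(\<integral>t. indicator (off_diag_gap \<epsilon>) (s, t) *\<^sub>R g s t \<partial>lborel) =
      indicator {0..<L} s *\<^sub>R (\<integral>t. indicator {s + \<epsilon>..s + L - \<epsilon>} t *\<^sub>R g s t \<partial>lborel)"
      by (cases "s \<in> {0..<L}") (auto simp: off_diag_gap_def indicator_def intro!: Bochner_Integration.integral_cong)
  qed
  finally show ?thesis .
qed

lemma chord_bounds_off_diag_gap:
  assumes "0 < \<epsilon>" "(s, t) \<in> off_diag_gap \<epsilon>"
  shows "c * \<epsilon> \<le> norm (f s - f t)" "norm (f s - f t) \<le> L / 2"
    "norm (f s - f t) \<le> circle_dist L s t" "0 < c * \<epsilon>"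
  using chord_bounds[of \<epsilon> s t] assms by (auto simp: off_diag_gap_def)

section \<open>The densities, their signs and their integrability\<close>

definition energy_density :: "real \<Rightarrow> real \<Rightarrow> real" where
  "energy_density s t = h (norm (f s - f t)) - h (circle_dist L s t)"

definition energy4_density :: "real \<Rightarrow> real \<Rightarrow> real" where
  "energy4_density s t = 1 / 2 * (h (norm (f s - f t)) + Lam (norm (f s - f t))) * (1 - T s \<bullet> T t)"

text \<open>For unit tangents and distinct points the last factor is half the squared distance
  between \<open>T s\<close> and the mirror image of \<open>T t\<close> in the chord direction. It
  measures how far the tangents are from meeting the chord symmetrically, as they do on a
  circle.\<close>

definition defect_density :: "real \<Rightarrow> real \<Rightarrow> real" where
  "defect_density s t = 1 / 2 * (h (norm (f s - f t)) - Lam (norm (f s - f t))) *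
     (1 + T s \<bullet> T t - 2 * (((f s - f t) \<bullet> T s) * ((f s - f t) \<bullet> T t) / (norm (f s - f t))\<^sup>2))"

lemma
  shows borel_measurable_energy_density[measurable]: "(\<lambda>p. energy_density (fst p) (snd p)) \<in> borel_measurable (lborel \<Otimes>\<^sub>M lborel)"
    and borel_measurable_defect_density[measurable]: "(\<lambda>p. defect_density (fst p) (snd p)) \<in> borel_measurable (lborel \<Otimes>\<^sub>M lborel)"
    and borel_measurable_energy4_density[measurable]: "(\<lambda>p. energy4_density (fst p) (snd p)) \<in> borel_measurable (lborel \<Otimes>\<^sub>M lborel)"
  unfolding energy_density_def defect_density_def energy4_density_def by measurable

text \<open>Write \<open>q\<close> for the quotient of inner products. The first two densities add
  up to \<open>h - Lam * (T s \<bullet> T t) - (h - Lam) * q\<close>, which is \<open>h\<close>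
  minus \<open>mixed_density\<close>.\<close>

lemma energy_density_decomposition: "energy_density s t = energy4_density s t + defect_density s t + mixed_density s t - h (circle_dist L s t)"
  unfolding energy_density_def energy4_density_def defect_density_def mixed_density_def by (simp add: field_simps)

lemma energy_density_nonneg: "0 < norm (f s - f t) \<Longrightarrow> 0 \<le> energy_density s t"
  unfolding energy_density_def using h_antimono[OF _ chord_le[of s t]] by simp

text \<open>Reflecting \<open>T t\<close> in the line spanned by the chord \<open>x\<close> preserves its norm.\<close>
lemma reflection_le: "2 * ((x \<bullet> T s) * (x \<bullet> T t) / (norm x)\<^sup>2) - T s \<bullet> T t \<le> 1"
proof (cases "x = 0")
  case True
  then show ?thesis using T_inner_T_le[of s t] by simp
next
  case False
  let ?r = "(2 * (x \<bullet> T t) / (norm x)\<^sup>2) *\<^sub>R x - T t"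
  have "?r \<bullet> ?r = T t \<bullet> T t"
    using False by (simp add: inner_diff_left inner_diff_right inner_commute power2_norm_eq_inner field_simps)
  then have "norm ?r = norm (T t)" by (simp add: norm_eq_sqrt_inner)
  have "2 * ((x \<bullet> T s) * (x \<bullet> T t) / (norm x)\<^sup>2) - T s \<bullet> T t = ?r \<bullet> T s"
    by (simp add: inner_diff_left inner_commute[of "T t"] mult.commute)
  also have "\<dots> \<le> norm ?r" using inner_T_le[of ?r s] by simp
  also have "\<dots> \<le> 1" using \<open>norm ?r = norm (T t)\<close> T_le_1 by simp
  finally show ?thesis .
qed

lemma defect_density_nonneg: "0 \<le> defect_density s t"
  unfolding defect_density_def using reflection_le[of "f s - f t" s t] Lam_nonpos[of "norm (f s - f t)"] h_nonneg[of "norm (f s - f t)"]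
  by (intro mult_nonneg_nonneg) auto

lemma energy4_density_nonneg: "0 \<le> h (norm (f s - f t)) + Lam (norm (f s - f t)) \<Longrightarrow> 0 \<le> energy4_density s t"
  unfolding energy4_density_def using T_inner_T_le[of s t] by (intro mult_nonneg_nonneg) auto

text \<open>The strip has finite measure, and on it chords and arcs are at least
  \<open>c * \<epsilon>\<close>, which bounds \<open>h\<close> and \<open>Lam\<close>; the inner
  products are bounded by Cauchy-Schwarz.\<close>

lemma set_integrable_off_diag_gap:
  assumes "0 < \<epsilon>"
  shows "set_integrable (lborel \<Otimes>\<^sub>M lborel) (off_diag_gap \<epsilon>) (\<lambda>p. energy_density (fst p) (snd p))"
    "set_integrable (lborel \<Otimes>\<^sub>M lborel) (off_diag_gap \<epsilon>) (\<lambda>p. defect_density (fst p) (snd p))"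
    "set_integrable (lborel \<Otimes>\<^sub>M lborel) (off_diag_gap \<epsilon>) (\<lambda>p. energy4_density (fst p) (snd p))"
    "set_integrable (lborel \<Otimes>\<^sub>M lborel) (off_diag_gap \<epsilon>) (\<lambda>p. mixed_density (fst p) (snd p))"
    "set_integrable (lborel \<Otimes>\<^sub>M lborel) (off_diag_gap \<epsilon>) (\<lambda>p. h (circle_dist L (fst p) (snd p)))"
proof -
  define \<delta> where "\<delta> = c * \<epsilon>"
  have d: "0 < \<delta>" using assms c_pos by (simp add: \<delta>_def)
  define M where "M = H \<delta> / \<delta>"
  have bounds: "0 \<le> h (norm (f s - f t))" "h (norm (f s - f t)) \<le> h \<delta>" "\<bar>Lam (norm (f s - f t))\<bar> \<le> M"
    "0 \<le> h (circle_dist L s t)" "h (circle_dist L s t) \<le> h \<delta>" if "(s, t) \<in> off_diag_gap \<epsilon>" for s t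
    using chord_bounds_off_diag_gap[OF assms that] h_antimono[of \<delta> "norm (f s - f t)"] h_antimono[of \<delta> "circle_dist L s t"] h_nonneg d
      abs_Lam_le[OF d, of "norm (f s - f t)"] by (auto simp: \<delta>_def M_def)
  have ab: "\<bar>((f s - f t) \<bullet> T s) * ((f s - f t) \<bullet> T t) / (norm (f s - f t))\<^sup>2\<bar> \<le> 1" for s t
  proof -
    have "\<bar>((f s - f t) \<bullet> T s) * ((f s - f t) \<bullet> T t)\<bar> \<le> (norm (f s - f t))\<^sup>2"
      unfolding abs_mult power2_eq_square by (intro mult_mono inner_T_le) auto
    then show ?thesis by (cases "f s = f t") (simp_all add: field_simps)
  qed
  show "set_integrable (lborel \<Otimes>\<^sub>M lborel) (off_diag_gap \<epsilon>) (\<lambda>p. h (circle_dist L (fst p) (snd p)))"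
    by (rule integrable_off_diag_gap[OF _ assms, where B="h \<delta>" and g="\<lambda>s t. h (circle_dist L s t)"]) (use bounds in auto)
  show "set_integrable (lborel \<Otimes>\<^sub>M lborel) (off_diag_gap \<epsilon>) (\<lambda>p. energy_density (fst p) (snd p))"
    by (rule integrable_off_diag_gap[OF _ assms, where B="h \<delta>"]) (use bounds in \<open>force simp: energy_density_def\<close>)+
  show "set_integrable (lborel \<Otimes>\<^sub>M lborel) (off_diag_gap \<epsilon>) (\<lambda>p. energy4_density (fst p) (snd p))"
  proof (rule integrable_off_diag_gap[OF _ assms])
    fix s t assume st: "(s, t) \<in> off_diag_gap \<epsilon>"
    show "\<bar>energy4_density s t\<bar> \<le> 1 / 2 * (h \<delta> + M) * 2"
      unfolding energy4_density_def abs_mult using bounds[OF st] T_inner_T_le[of s t] by (intro mult_mono) auto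
  qed measurable
  show "set_integrable (lborel \<Otimes>\<^sub>M lborel) (off_diag_gap \<epsilon>) (\<lambda>p. defect_density (fst p) (snd p))"
  proof (rule integrable_off_diag_gap[OF _ assms])
    fix s t assume st: "(s, t) \<in> off_diag_gap \<epsilon>"
    have "\<bar>1 + T s \<bullet> T t - 2 * (((f s - f t) \<bullet> T s) * ((f s - f t) \<bullet> T t) / (norm (f s - f t))\<^sup>2)\<bar> \<le> 4"
      using T_inner_T_le[of s t] ab[of s t] by linarith
    then show "\<bar>defect_density s t\<bar> \<le> 1 / 2 * (h \<delta> + M) * 4"
      unfolding defect_density_def abs_mult[of _ "1 + _ - _"] abs_mult[of "1 / 2"]
      using bounds[OF st]
      by (intro mult_mono) (auto simp del: times_divide_eq_left times_divide_eq_right)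
  qed measurable
  show "set_integrable (lborel \<Otimes>\<^sub>M lborel) (off_diag_gap \<epsilon>) (\<lambda>p. mixed_density (fst p) (snd p))"
  proof (rule integrable_off_diag_gap[OF _ assms])
    fix s t assume st: "(s, t) \<in> off_diag_gap \<epsilon>"
    have "\<bar>mixed_density s t\<bar> \<le> M * 1 + (h \<delta> + M) * 1"
      unfolding mixed_density_def
      by (rule order_trans[OF abs_triangle_ineq], unfold abs_mult[of "Lam _"] abs_mult[of "_ - _"], intro add_mono mult_mono)
        (use bounds[OF st] T_inner_T_le[of s t] ab[of s t] in auto)
    then show "\<bar>mixed_density s t\<bar> \<le> M * 1 + (h \<delta> + M) * 1" .
  qed measurable
qed

text \<open>The part \<open>- 2 * L * H \<epsilon>\<close> of the integral of
  \<open>h (circle_dist L s t)\<close> is rewritten through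
  \<open>H \<epsilon> = - \<epsilon> * Lam \<epsilon>\<close> and grouped with the boundary
  integral. The resulting bracket is what the two limits in \<open>cond_A4\<close> control.\<close>

lemma integral_off_diag_gap_decomposition:
  assumes eps: "0 < \<epsilon>" "\<epsilon> \<le> L / 2"
  shows "(LINT p:off_diag_gap \<epsilon>|lborel \<Otimes>\<^sub>M lborel. energy_density (fst p) (snd p)) + 2 * ((LINT s:{0..<L}|lborel. left_boundary \<epsilon> s) - L * \<epsilon> * Lam \<epsilon>) =
    (LINT p:off_diag_gap \<epsilon>|lborel \<Otimes>\<^sub>M lborel. energy4_density (fst p) (snd p)) +
    (LINT p:off_diag_gap \<epsilon>|lborel \<Otimes>\<^sub>M lborel. defect_density (fst p) (snd p)) + 2 * L * H (L / 2)"
proof -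
  note int = set_integrable_off_diag_gap[OF eps(1)]
  have 1: "(LINT p:off_diag_gap \<epsilon>|lborel \<Otimes>\<^sub>M lborel. h (circle_dist L (fst p) (snd p))) = L * (2 * (H \<epsilon> - H (L / 2)))"
    using set_integral_off_diag_gap[of \<epsilon> "\<lambda>s t. h (circle_dist L s t)", OF int(5)] integral_circle_dist[OF eps] L_pos
    by (simp add: set_lebesgue_integral_def)
  have 2: "(LINT p:off_diag_gap \<epsilon>|lborel \<Otimes>\<^sub>M lborel. mixed_density (fst p) (snd p)) = - 2 * (LINT s:{0..<L}|lborel. left_boundary \<epsilon> s)"
    using set_integral_off_diag_gap[OF int(4)] integral_integral_mixed_density[OF eps] by simp
  have "(LINT p:off_diag_gap \<epsilon>|lborel \<Otimes>\<^sub>M lborel. energy_density (fst p) (snd p)) =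
      (LINT p:off_diag_gap \<epsilon>|lborel \<Otimes>\<^sub>M lborel. energy4_density (fst p) (snd p)) + (LINT p:off_diag_gap \<epsilon>|lborel \<Otimes>\<^sub>M lborel. defect_density (fst p) (snd p)) +
      (LINT p:off_diag_gap \<epsilon>|lborel \<Otimes>\<^sub>M lborel. mixed_density (fst p) (snd p)) -
      (LINT p:off_diag_gap \<epsilon>|lborel \<Otimes>\<^sub>M lborel. h (circle_dist L (fst p) (snd p)))"
    unfolding energy_density_decomposition using int by (simp add: set_integral_add set_integral_diff)
  moreover have "L * \<epsilon> * Lam \<epsilon> = - (L * H \<epsilon>)" using mult_Lam[OF eps(1)] by (simp add: mult.assoc)
  ultimately show ?thesis unfolding 1 2 by (simp add: algebra_simps)
qed

text \<open>Monotone convergence along shrinking gaps. Starting the sequence at \<open>L / 2\<close>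
  keeps every gap in the range where the truncated identities hold.\<close>

lemma nn_integral_off_diag_gap_LIMSEQ:
  assumes [measurable]: "g \<in> borel_measurable (lborel \<Otimes>\<^sub>M lborel)"
  shows "(\<lambda>k. \<integral>\<^sup>+p\<in>off_diag_gap (L / Suc (Suc k)). g p \<partial>(lborel \<Otimes>\<^sub>M lborel)) \<longlonglongrightarrow> (\<integral>\<^sup>+p\<in>off_diag. g p \<partial>(lborel \<Otimes>\<^sub>M lborel))"
proof (rule nn_integral_LIMSEQ)
  have sub: "off_diag_gap (L / Suc (Suc m)) \<subseteq> off_diag_gap (L / Suc (Suc n))" if "m \<le> n" for m n
  proof -
    have "L / Suc (Suc n) \<le> L / Suc (Suc m)" using that L_pos by (intro divide_left_mono) auto
    then show ?thesis unfolding off_diag_gap_def by auto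
  qed
  show "incseq (\<lambda>k p. g p * indicator (off_diag_gap (L / Suc (Suc k))) p)"
    using sub by (auto simp: incseq_def le_fun_def indicator_def)
  fix p :: "real \<times> real"
  have "eventually (\<lambda>k. g p * indicator (off_diag_gap (L / Suc (Suc k))) p = g p * indicator off_diag p) sequentially"
  proof (cases "p \<in> off_diag")
    case True
    then have "0 < min (snd p - fst p) (fst p + L - snd p)" by (auto simp: off_diag_def)
    moreover have "(\<lambda>k. L / Suc (Suc k)) \<longlonglongrightarrow> 0"
      using LIMSEQ_Suc[OF LIMSEQ_Suc[OF lim_const_over_n]] .
    ultimately have "eventually (\<lambda>k. L / Suc (Suc k) < min (snd p - fst p) (fst p + L - snd p)) sequentially"
      by (rule order_tendstoD(2)[rotated])
    then show ?thesis by eventually_elim (use True in \<open>auto simp: off_diag_gap_def off_diag_def indicator_def\<close>)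
  next
    case False
    have "p \<notin> off_diag_gap (L / Suc (Suc k))" for k
    proof
      assume "p \<in> off_diag_gap (L / Suc (Suc k))"
      moreover have "0 < L / Suc (Suc k)" using L_pos by simp
      ultimately show False using False unfolding off_diag_gap_def off_diag_def mem_Collect_eq by linarith
    qed
    then show ?thesis using False by simp
  qed
  then show "(\<lambda>k. g p * indicator (off_diag_gap (L / Suc (Suc k))) p) \<longlonglongrightarrow> g p * indicator off_diag p"
    by (rule tendsto_eventually)
qed measurable

text \<open>For each \<open>s\<close>, periodicity in \<open>t\<close> replaces the period
  \<open>[0, L)\<close> by \<open>[s, s + L)\<close>, whose endpoint \<open>t = s\<close> is a null
  set.\<close>

lemma nn_integral_off_diag_eq_square:
  fixes g :: "real \<Rightarrow> real \<Rightarrow> ennreal"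
  assumes [measurable]: "(\<lambda>p. g (fst p) (snd p)) \<in> borel_measurable (lborel \<Otimes>\<^sub>M lborel)"
    and per: "\<And>s t. g s (t + L) = g s t"
  shows "(\<integral>\<^sup>+p\<in>{0..<L} \<times> {0..<L}. g (fst p) (snd p) \<partial>lborel) =
    (\<integral>\<^sup>+p\<in>off_diag. g (fst p) (snd p) \<partial>(lborel \<Otimes>\<^sub>M lborel))"
proof -
  have "(\<integral>\<^sup>+p\<in>{0..<L} \<times> {0..<L}. g (fst p) (snd p) \<partial>lborel) =
      (\<integral>\<^sup>+p\<in>{0..<L} \<times> {0..<L}. g (fst p) (snd p) \<partial>(lborel \<Otimes>\<^sub>M lborel))"
    by (simp add: lborel_prod)
  also have "\<dots> = (\<integral>\<^sup>+s. \<integral>\<^sup>+t. g s t * indicator ({0..<L} \<times> {0..<L}) (s, t) \<partial>lborel \<partial>lborel)"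
    by (subst lborel.nn_integral_fst[symmetric]) simp_all
  also have "\<dots> = (\<integral>\<^sup>+s. \<integral>\<^sup>+t. g s t * indicator off_diag (s, t) \<partial>lborel \<partial>lborel)"
  proof (rule nn_integral_cong)
    fix s :: real
    have [measurable]: "g s \<in> borel_measurable borel"
    proof -
      have "(\<lambda>t. (\<lambda>p. g (fst p) (snd p)) (s, t)) \<in> borel_measurable lborel" by measurable
      then show ?thesis by simp
    qed
    show "(\<integral>\<^sup>+t. g s t * indicator ({0..<L} \<times> {0..<L}) (s, t) \<partial>lborel) =
        (\<integral>\<^sup>+t. g s t * indicator off_diag (s, t) \<partial>lborel)"
    proof (cases "s \<in> {0..<L}")
      case True
      then have "(\<integral>\<^sup>+t. g s t * indicator ({0..<L} \<times> {0..<L}) (s, t) \<partial>lborel) =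
          (\<integral>\<^sup>+t. g s t * indicator {0..<L} t \<partial>lborel)" by (simp add: indicator_def)
      also have "\<dots> = (\<integral>\<^sup>+t. g s t * indicator {s..<s + L} t \<partial>lborel)"
        using True by (intro nn_integral_periodic[symmetric]) (auto simp: per)
      also have "\<dots> = (\<integral>\<^sup>+t. g s t * indicator off_diag (s, t) \<partial>lborel)"
        using AE_lborel_singleton[of s] True
        by (intro nn_integral_cong_AE) (auto elim!: eventually_mono simp: off_diag_def indicator_def)
      finally show ?thesis .
    next
      case False
      then show ?thesis by (auto simp: off_diag_def indicator_def intro!: nn_integral_cong)
    qed
  qed
  also have "\<dots> = (\<integral>\<^sup>+p\<in>off_diag. g (fst p) (snd p) \<partial>(lborel \<Otimes>\<^sub>M lborel))"
    by (subst lborel.nn_integral_fst[symmetric]) simp_all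
  finally show ?thesis .
qed

lemma nn_integral_off_diag_gap:
  fixes g :: "real \<Rightarrow> real \<Rightarrow> real"
  assumes "set_integrable (lborel \<Otimes>\<^sub>M lborel) (off_diag_gap \<epsilon>) (\<lambda>p. g (fst p) (snd p))"
    and nonneg: "\<And>s t. (s, t) \<in> off_diag_gap \<epsilon> \<Longrightarrow> 0 \<le> g s t"
  shows "(\<integral>\<^sup>+p\<in>off_diag_gap \<epsilon>. ennreal (g (fst p) (snd p)) \<partial>(lborel \<Otimes>\<^sub>M lborel)) =
      ennreal (LINT p:off_diag_gap \<epsilon>|lborel \<Otimes>\<^sub>M lborel. g (fst p) (snd p))"
    and "0 \<le> (LINT p:off_diag_gap \<epsilon>|lborel \<Otimes>\<^sub>M lborel. g (fst p) (snd p))"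
proof -
  have "(\<integral>\<^sup>+p. ennreal (indicator (off_diag_gap \<epsilon>) p *\<^sub>R g (fst p) (snd p)) \<partial>(lborel \<Otimes>\<^sub>M lborel)) =
      ennreal (LINT p:off_diag_gap \<epsilon>|lborel \<Otimes>\<^sub>M lborel. g (fst p) (snd p))"
    unfolding set_lebesgue_integral_def
    by (rule nn_integral_eq_integral) (use assms in \<open>auto simp: set_integrable_def indicator_def\<close>)
  moreover have "(\<integral>\<^sup>+p. ennreal (indicator (off_diag_gap \<epsilon>) p *\<^sub>R g (fst p) (snd p)) \<partial>(lborel \<Otimes>\<^sub>M lborel)) =
      (\<integral>\<^sup>+p\<in>off_diag_gap \<epsilon>. ennreal (g (fst p) (snd p)) \<partial>(lborel \<Otimes>\<^sub>M lborel))"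
    by (intro nn_integral_cong) (auto simp: indicator_def)
  ultimately show "(\<integral>\<^sup>+p\<in>off_diag_gap \<epsilon>. ennreal (g (fst p) (snd p)) \<partial>(lborel \<Otimes>\<^sub>M lborel)) =
      ennreal (LINT p:off_diag_gap \<epsilon>|lborel \<Otimes>\<^sub>M lborel. g (fst p) (snd p))" by simp
  show "0 \<le> (LINT p:off_diag_gap \<epsilon>|lborel \<Otimes>\<^sub>M lborel. g (fst p) (snd p))"
    unfolding set_lebesgue_integral_def
    by (rule Bochner_Integration.integral_nonneg) (use nonneg in \<open>auto simp: indicator_def\<close>)
qed

text \<open>Both sides are limits of the truncated identity. The two densities on the right converge
  monotonically in \<open>[0, \<infinity>]\<close> without presupposed integrability, and uniqueness
  of limits gives the equation.\<close>

lemma energy_decomposition: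
  assumes adm: "\<And>x. 0 < x \<Longrightarrow> x \<le> L / 2 \<Longrightarrow> 0 \<le> h x + Lam x"
    and lim1: "((\<lambda>\<epsilon>. \<epsilon> * (LINT s:{0..<L}|lborel. Lam (norm (f s - f (s + \<epsilon>))) - Lam \<epsilon>)) \<longlongrightarrow> 0) (at_right 0)"
    and lim2: "((\<lambda>\<epsilon>. LINT s:{0..<L}|lborel. Lam (norm (f s - f (s + \<epsilon>))) *
               (LINT t:{s..s + \<epsilon>}|lborel. (norm (T s - T t))\<^sup>2)) \<longlongrightarrow> 0) (at_right 0)"
    and fin: "(\<integral>\<^sup>+p\<in>off_diag. ennreal (energy_density (fst p) (snd p)) \<partial>(lborel \<Otimes>\<^sub>M lborel)) < \<infinity>"
  shows "(\<integral>\<^sup>+p\<in>off_diag. ennreal (energy_density (fst p) (snd p)) \<partial>(lborel \<Otimes>\<^sub>M lborel)) =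
    (\<integral>\<^sup>+p\<in>off_diag. ennreal (energy4_density (fst p) (snd p)) \<partial>(lborel \<Otimes>\<^sub>M lborel)) +
    (\<integral>\<^sup>+p\<in>off_diag. ennreal (defect_density (fst p) (snd p)) \<partial>(lborel \<Otimes>\<^sub>M lborel)) + ennreal (2 * L * H (L / 2))"
    (is "?E = ?E4 + ?E3 + ennreal ?\<kappa>")
proof -
  define \<epsilon> where "\<epsilon> k = L / Suc (Suc k)" for k
  have eps: "0 < \<epsilon> k" "\<epsilon> k \<le> L / 2" for k
    using L_pos by (simp_all add: \<epsilon>_def field_simps)
  have "\<epsilon> \<longlonglongrightarrow> 0"
    unfolding \<epsilon>_def using LIMSEQ_Suc[OF LIMSEQ_Suc[OF lim_const_over_n]] .
  then have lim_eps: "filterlim \<epsilon> (at_right 0) sequentially"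
    by (rule tendsto_imp_filterlim_at_right) (simp add: eps(1))
  define a where "a k = (LINT p:off_diag_gap (\<epsilon> k)|lborel \<Otimes>\<^sub>M lborel. energy_density (fst p) (snd p))" for k
  define a4 where "a4 k = (LINT p:off_diag_gap (\<epsilon> k)|lborel \<Otimes>\<^sub>M lborel. energy4_density (fst p) (snd p))" for k
  define a3 where "a3 k = (LINT p:off_diag_gap (\<epsilon> k)|lborel \<Otimes>\<^sub>M lborel. defect_density (fst p) (snd p))" for k
  define b where "b \<epsilon> = 2 * ((LINT s:{0..<L}|lborel. left_boundary \<epsilon> s) - L * \<epsilon> * Lam \<epsilon>)" for \<epsilon>
  have eq: "a k + b (\<epsilon> k) = a4 k + a3 k + ?\<kappa>" for k
    using integral_off_diag_gap_decomposition[OF eps, of k] by (simp add: a_def a4_def a3_def b_def)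
  have pos: "0 < norm (f s - f t)" "norm (f s - f t) \<le> L / 2" if "(s, t) \<in> off_diag_gap (\<epsilon> k)" for s t k
    using chord_bounds_off_diag_gap[OF eps(1) that] by linarith+
  note int = set_integrable_off_diag_gap[OF eps(1)]
  have nn: "(\<integral>\<^sup>+p\<in>off_diag_gap (\<epsilon> k). ennreal (energy_density (fst p) (snd p)) \<partial>(lborel \<Otimes>\<^sub>M lborel)) = ennreal (a k)" "0 \<le> a k"
    "(\<integral>\<^sup>+p\<in>off_diag_gap (\<epsilon> k). ennreal (energy4_density (fst p) (snd p)) \<partial>(lborel \<Otimes>\<^sub>M lborel)) = ennreal (a4 k)" "0 \<le> a4 k"
    "(\<integral>\<^sup>+p\<in>off_diag_gap (\<epsilon> k). ennreal (defect_density (fst p) (snd p)) \<partial>(lborel \<Otimes>\<^sub>M lborel)) = ennreal (a3 k)" "0 \<le> a3 k" for k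
    unfolding a_def a3_def a4_def
    by (intro nn_integral_off_diag_gap int energy_density_nonneg defect_density_nonneg energy4_density_nonneg adm; use pos in blast)+
  have lim: "(\<lambda>k. ennreal (a k)) \<longlonglongrightarrow> ?E" "(\<lambda>k. ennreal (a4 k)) \<longlonglongrightarrow> ?E4" "(\<lambda>k. ennreal (a3 k)) \<longlonglongrightarrow> ?E3"
    unfolding nn(1,3,5)[symmetric] \<epsilon>_def by (intro nn_integral_off_diag_gap_LIMSEQ; measurable)+
  have "((\<lambda>\<epsilon>. 2 * (\<epsilon> * (LINT s:{0..<L}|lborel. Lam (norm (f s - f (s + \<epsilon>))) - Lam \<epsilon>) -
      1 / 2 * (LINT s:{0..<L}|lborel. Lam (norm (f s - f (s + \<epsilon>))) *
               (LINT t:{s..s + \<epsilon>}|lborel. (norm (T s - T t))\<^sup>2)))) \<longlongrightarrow> 2 * (0 - 1 / 2 * 0)) (at_right 0)"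
    by (intro tendsto_intros lim1 lim2)
  from filterlim_compose[OF this lim_eps] have b0: "(\<lambda>k. b (\<epsilon> k)) \<longlonglongrightarrow> 0"
    unfolding b_def integral_left_boundary[OF eps] by simp
  \<comment> \<open>The boundary term has no definite sign and cannot be added in
    \<open>ennreal\<close>. Finite energy allows the passage to real limits, where adding a null
    sequence is harmless.\<close>
  have fin': "ennreal (enn2real ?E) = ?E" using fin by simp
  have "(\<lambda>k. a k) \<longlonglongrightarrow> enn2real ?E"
  proof (rule tendsto_ennrealD)
    show "(\<lambda>k. ennreal (a k)) \<longlonglongrightarrow> ennreal (enn2real ?E)" using lim(1) fin' by simp
  qed (simp_all add: nn(2))
  from tendsto_add[OF this b0] have "(\<lambda>k. a4 k + a3 k + ?\<kappa>) \<longlonglongrightarrow> enn2real ?E"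
    unfolding eq by simp
  from tendsto_ennrealI[OF this]
  have lim_E: "(\<lambda>k. ennreal (a4 k + a3 k + ?\<kappa>)) \<longlonglongrightarrow> ?E" unfolding fin' .
  have "0 \<le> ?\<kappa>" using L_pos H_nonneg by simp
  then have "ennreal (a4 k + a3 k + ?\<kappa>) = ennreal (a4 k) + ennreal (a3 k) + ennreal ?\<kappa>" for k
    using nn(4,6)[of k] by (simp add: ennreal_plus)
  then have "(\<lambda>k. ennreal (a4 k + a3 k + ?\<kappa>)) = (\<lambda>k. ennreal (a4 k) + ennreal (a3 k) + ennreal ?\<kappa>)"
    by (rule ext)
  also have "\<dots> \<longlonglongrightarrow> ?E4 + ?E3 + ennreal ?\<kappa>"
    by (rule tendsto_add[OF tendsto_add[OF lim(2,3)] tendsto_const])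
  finally show ?thesis using lim_E by (rule LIMSEQ_unique[rotated])
qed

end

section \<open>Comparison with the round circle\<close>

text \<open>Where \<open>f\<close> has no derivative, \<open>tangent f\<close> is an arbitrary
  vector, possibly long; the value 0 restores the bound by 1 at every point.\<close>

definition unit_tangent :: "(real \<Rightarrow> real^'n) \<Rightarrow> real \<Rightarrow> real^'n" where
  "unit_tangent f s = (if norm (tangent f s) = 1 then tangent f s else 0)"

lemma closed_curve_unit_tangent:
  fixes f :: "real \<Rightarrow> real^'n"
  assumes "0 < L" and f: "arclength_closed_curve L f"
    and "0 < c" "\<And>s t. c * circle_dist L s t \<le> norm (f s - f t)"
  shows "closed_curve L c f (unit_tangent f)"
    and "AE s in lborel. unit_tangent f s = tangent f s"
    and "tangent f \<in> borel_measurable borel"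
proof -
  obtain K where K: "K-lipschitz_on UNIV f" using f by (auto simp: arclength_closed_curve_def)
  have per: "f (s + L) = f s" for s using f by (simp add: arclength_closed_curve_def circle_periodic_def)
  have [measurable]: "tangent f \<in> borel_measurable borel"
    unfolding tangent_def[abs_def]
    by (rule borel_measurable_vector_derivative[OF lipschitz_on_continuous_on[OF K]])
  then show "tangent f \<in> borel_measurable borel" .
  have AE: "AE s in lborel. \<exists>v. (f has_vector_derivative v) (at s) \<and> norm v = 1"
    using f by (simp add: arclength_closed_curve_def)
  then have tan: "AE s in lborel. (f has_vector_derivative tangent f s) (at s) \<and> norm (tangent f s) = 1"
    unfolding tangent_def by eventually_elim (auto simp: vector_derivative_at)
  then show AE_eq: "AE s in lborel. unit_tangent f s = tangent f s"
    by eventually_elim (simp add: unit_tangent_def)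
  \<comment> \<open>The derivative relations at \<open>s\<close> and \<open>s + L\<close> coincide
    as predicates in \<open>v\<close>, so the choice made by \<open>vector_derivative\<close> is
    periodic also where no derivative exists.\<close>
  have "(f has_vector_derivative v) (at (s + L)) \<longleftrightarrow> (f has_vector_derivative v) (at s)" for s v
  proof -
    have "f (s + L + h) = f (s + h)" for h using per[of "s + h"] by (simp add: add.assoc add.commute[of h])
    then show ?thesis by (simp add: has_vector_derivative_iff_tendsto per)
  qed
  then have tan_per: "tangent f (s + L) = tangent f s" for s
    by (simp add: tangent_def vector_derivative_def)
  show "closed_curve L c f (unit_tangent f)"
  proof
    show "unit_tangent f \<in> borel_measurable borel"
      unfolding unit_tangent_def[abs_def] by measurable
    show "AE s in lborel. (f has_vector_derivative unit_tangent f s) (at s)"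
      "AE s in lborel. norm (unit_tangent f s) = 1"
      using tan by (eventually_elim; simp add: unit_tangent_def)+
  qed (use assms K in \<open>auto simp: per tan_per unit_tangent_def\<close>)
qed

context weighted_curve
begin

lemma chord_pos:
  assumes "0 \<le> s" "s < L" "0 \<le> t" "t < L" "s \<noteq> t"
  shows "0 < norm (f s - f t)" "norm (f s - f t) \<le> L / 2"
proof -
  have *: "0 < norm (f s - f t) \<and> norm (f s - f t) \<le> L / 2" if "s < t" "t < s + L" for s t
  proof -
    define r where "r = min (t - s) (s + L - t)"
    have "0 < r" "s + r \<le> t" "t \<le> s + L - r" using that by (auto simp: r_def)
    from chord_bounds[OF this] show ?thesis by linarith
  qed
  show "0 < norm (f s - f t)" "norm (f s - f t) \<le> L / 2"
    using *[of s t] *[of t s] assms by (cases s t rule: linorder_cases; simp add: norm_minus_commute)+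
qed

text \<open>The bridge from integrands written with \<open>\<Phi>\<close> and \<open>tangent\<close>
  to the Borel densities. They need to agree only off the diagonal and for parameters in a set of
  full measure, both of which ignore null sets of the square.\<close>

lemma torus_nn_integral_eq:
  assumes [measurable]: "(\<lambda>p. g (fst p) (snd p)) \<in> borel_measurable (lborel \<Otimes>\<^sub>M lborel)"
    and per: "\<And>s t. g s (t + L) = g s t"
    and S: "AE s in lborel. s \<in> S"
    and eq: "\<And>s t. s \<in> S \<Longrightarrow> t \<in> S \<Longrightarrow> 0 \<le> s \<Longrightarrow> s < L \<Longrightarrow> 0 \<le> t \<Longrightarrow> t < L \<Longrightarrow> s \<noteq> t \<Longrightarrow> k s t = g s t"
  shows "torus_nn_integral L k = (\<integral>\<^sup>+p\<in>off_diag. ennreal (g (fst p) (snd p)) \<partial>(lborel \<Otimes>\<^sub>M lborel))"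
proof -
  obtain N where N: "N \<in> null_sets lborel" "{x. x \<notin> S} \<subseteq> N"
    using S by (auto elim!: AE_E simp: null_sets_def)
  then have [measurable]: "N \<in> sets borel" by (auto simp: null_sets_def)
  have "AE p in lborel \<Otimes>\<^sub>M lborel. fst p \<noteq> snd p \<and> fst p \<notin> N \<and> snd p \<notin> N"
  proof (rule AE_lborel_prodI)
    have "AE s in lborel. s \<notin> N" using N(1) by (rule AE_not_in)
    then show "AE s in lborel. AE t in lborel. fst (s, t) \<noteq> snd (s, t) \<and> fst (s, t) \<notin> N \<and> snd (s, t) \<notin> N"
    proof eventually_elim
      case (elim s)
      show ?case using AE_lborel_singleton[of s] AE_not_in[OF N(1)] by eventually_elim (use elim in auto)
    qed
    have "Measurable.pred (borel \<Otimes>\<^sub>M borel) (\<lambda>p::real \<times> real. fst p \<noteq> snd p \<and> fst p \<notin> N \<and> snd p \<notin> N)"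
      by measurable
    then show "Measurable.pred borel (\<lambda>p::real \<times> real. fst p \<noteq> snd p \<and> fst p \<notin> N \<and> snd p \<notin> N)"
      by (simp add: borel_prod)
  qed
  then have AE: "AE p in lborel. fst p \<noteq> snd p \<and> fst p \<notin> N \<and> snd p \<notin> (N :: real set)"
    unfolding lborel_prod .
  have "torus_nn_integral L k = (\<integral>\<^sup>+p\<in>{0..<L} \<times> {0..<L}. ennreal (g (fst p) (snd p)) \<partial>lborel)"
    unfolding torus_nn_integral_def
  proof (rule nn_integral_cong_AE)
    show "AE p in lborel. ennreal (k (fst p) (snd p)) * indicator ({0..<L} \<times> {0..<L}) p =
        ennreal (g (fst p) (snd p)) * indicator ({0..<L} \<times> {0..<L}) p"
      using AE
    proof eventually_elim
      case (elim p)
      then have "fst p \<in> S" "snd p \<in> S" using N(2) by auto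
      then show ?case using elim eq[of "fst p" "snd p"] by (cases p) (auto simp: indicator_def)
    qed
  qed
  also have "\<dots> = (\<integral>\<^sup>+p\<in>off_diag. ennreal (g (fst p) (snd p)) \<partial>(lborel \<Otimes>\<^sub>M lborel))"
    by (rule nn_integral_off_diag_eq_square) (auto simp: per)
  finally show ?thesis .
qed

lemma energy_density_add_period: "energy_density s (t + L) = energy_density s t" and energy4_density_add_period: "energy4_density s (t + L) = energy4_density s t"
  by (simp_all add: energy_density_def energy4_density_def f_add_period T_add_period circle_dist_add_period)

end

lemma enn2ereal_minus_zero: "enn2ereal x - enn2ereal 0 = enn2ereal x"
  by (simp add: zero_ennreal.rep_eq)

text \<open>Here \<open>d\<close> is the total defect. The condition forcing \<open>d = 0\<close> is
  phrased with \<open>tangent\<close> alone so that it can be checked on an explicit curve, and it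
  exempts coinciding points, where the quotient degenerates.\<close>

lemma energy_eq_energy4:
  fixes L :: real and \<Phi> :: "real \<Rightarrow> real" and f :: "real \<Rightarrow> real^'n"
  assumes L: "L > 0" and \<Phi>: "\<forall>t>0. \<Phi> t > 0"
    and A1: "cond_A1 \<Phi>" and A2: "cond_A2 \<Phi>"
    and A3: "cond_A3 TYPE('n) L \<Phi>" and A4: "cond_A4 TYPE('n) L \<Phi>" and A5: "cond_A5b L \<Phi>"
    and f: "f \<in> finite_energy_curves L \<Phi>"
  obtains d where "0 \<le> d"
    "energy L \<Phi> f = energy4 L \<Phi> f + d - ereal (L\<^sup>2 * Lambda \<Phi> (L / 2))"
    "(\<And>s t. 1 + tangent f s \<bullet> tangent f t =
       2 * (((f s - f t) \<bullet> tangent f s) * ((f s - f t) \<bullet> tangent f t) / (norm (f s - f t))\<^sup>2) \<or> f s = f t) \<Longrightarrow> d = 0"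
proof -
  define h where "h x = (if 0 < x then 1 / \<Phi> x else 0)" for x
  have antimono: "h y \<le> h x" if "0 < x" "x \<le> y" for x y
    using A1 \<Phi> that by (auto simp: h_def cond_A1_def mono_on_def intro!: divide_left_mono)
  interpret decreasing_weight h
  proof
    fix x :: real assume x: "0 < x"
    have "set_integrable lborel {x..} h \<longleftrightarrow> set_integrable lborel {x..} (\<lambda>t. 1 / \<Phi> t)"
      by (rule set_integrable_cong) (use x in \<open>auto simp: h_def\<close>)
    then show "set_integrable lborel {x..} h" using A2 x by (simp add: cond_A2_def)
  qed (use \<Phi> antimono in \<open>auto simp: h_def\<close>)
  \<comment> \<open>At 0 both sides vanish through division by zero; including this case covers
    every chord length, even for coinciding points.\<close>
  have Lam_eq: "Lambda \<Phi> x = Lam x" if "0 \<le> x" for x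
  proof (cases "x = 0")
    case False
    have "(LINT t:{x..}|lborel. 1 / \<Phi> t) = H x"
      unfolding H_def by (rule set_lebesgue_integral_cong) (use that False in \<open>auto simp: h_def\<close>)
    then show ?thesis using that False by (simp add: Lambda_def Lam_def)
  qed (simp add: Lambda_def Lam_def)
  have adm: "0 \<le> h x + Lam x" if "0 < x" "x \<le> L / 2" for x
  proof -
    have "0 \<le> ereal (1 / \<Phi> x + Lambda \<Phi> x)"
      using A5 that unfolding cond_A5b_def by (meson INF_lower2 greaterThanAtMost_iff order_refl order_trans)
    then show ?thesis using that by (simp add: h_def Lam_eq)
  qed
  have curve: "arclength_closed_curve L f" and fin: "energy L \<Phi> f < \<infinity>"
    using f by (auto simp: finite_energy_curves_def)
  then have W: "f \<in> W_Phi L \<Phi> \<inter> W1inf L" and bl: "bi_lipschitz L f"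
    using A3 by (auto simp: cond_A3_def)
  then obtain c where c: "0 < c" "\<And>s t. c * circle_dist L s t \<le> norm (f s - f t)"
    unfolding bi_lipschitz_def by blast
  define T where "T = unit_tangent f"
  note cc = closed_curve_unit_tangent[OF L curve c, folded T_def]
  interpret weighted_curve L c f T h
    using cc(1) decreasing_weight_axioms by (rule weighted_curve.intro)
  have [measurable]: "tangent f \<in> borel_measurable borel" by (rule cc(3))
  define E where "E = (\<integral>\<^sup>+p\<in>off_diag. ennreal (energy_density (fst p) (snd p)) \<partial>(lborel \<Otimes>\<^sub>M lborel))"
  define E4 where "E4 = (\<integral>\<^sup>+p\<in>off_diag. ennreal (energy4_density (fst p) (snd p)) \<partial>(lborel \<Otimes>\<^sub>M lborel))"
  define E3 where "E3 = (\<integral>\<^sup>+p\<in>off_diag. ennreal (defect_density (fst p) (snd p)) \<partial>(lborel \<Otimes>\<^sub>M lborel))"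
  have energy_density_eq: "1 / \<Phi> (norm (f s - f t)) - 1 / \<Phi> (circle_dist L s t) = energy_density s t \<and> 0 \<le> energy_density s t"
    if "0 \<le> s" "s < L" "0 \<le> t" "t < L" "s \<noteq> t" for s t
  proof -
    have "0 < circle_dist L s t" using chord_pos(1)[OF that] chord_le[of s t] by linarith
    then show ?thesis using chord_pos(1)[OF that] energy_density_nonneg[of s t] by (simp add: energy_density_def h_def)
  qed
  have energy4_density_eq: "Theta \<Phi> (norm (f s - f t)) * (1 - tangent f s \<bullet> tangent f t) / \<Phi> (norm (f s - f t)) = energy4_density s t \<and> 0 \<le> energy4_density s t"
    if "0 \<le> s" "s < L" "0 \<le> t" "t < L" "s \<noteq> t" "T s = tangent f s" "T t = tangent f t" for s t
  proof -
    have D: "0 < norm (f s - f t)" "norm (f s - f t) \<le> L / 2" using chord_pos[OF that(1-5)] .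
    have ratio: "Theta \<Phi> (norm (f s - f t)) / \<Phi> (norm (f s - f t)) = 1 / 2 * (h (norm (f s - f t)) + Lam (norm (f s - f t)))"
      using D \<Phi>[rule_format, OF D(1)] by (simp add: Theta_def h_def Lam_eq field_simps)
    have "Theta \<Phi> (norm (f s - f t)) * (1 - tangent f s \<bullet> tangent f t) / \<Phi> (norm (f s - f t)) =
        Theta \<Phi> (norm (f s - f t)) / \<Phi> (norm (f s - f t)) * (1 - tangent f s \<bullet> tangent f t)" by simp
    also have "\<dots> = energy4_density s t" unfolding ratio energy4_density_def that(6,7) ..
    finally show ?thesis using energy4_density_nonneg[of s t] adm[OF D] by simp
  qed
  have E: "energy L \<Phi> f = enn2ereal E"
  proof -
    have "torus_nn_integral L (\<lambda>s t. 1 / \<Phi> (norm (f s - f t)) - 1 / \<Phi> (circle_dist L s t)) = E"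
      unfolding E_def by (rule torus_nn_integral_eq[where S=UNIV]) (use energy_density_eq in \<open>auto simp: energy_density_add_period\<close>)
    \<comment> \<open>The negative part: off the diagonal the integrand equals its minimum with 0,
      and this minimum has \<open>ennreal\<close> value 0 everywhere, on the diagonal too.\<close>
    moreover have "torus_nn_integral L (\<lambda>s t. - (1 / \<Phi> (norm (f s - f t)) - 1 / \<Phi> (circle_dist L s t))) =
        (\<integral>\<^sup>+p\<in>off_diag. ennreal (min 0 (- energy_density (fst p) (snd p))) \<partial>(lborel \<Otimes>\<^sub>M lborel))"
      by (rule torus_nn_integral_eq[where S=UNIV and g="\<lambda>s t. min 0 (- energy_density s t)"])
        (use energy_density_eq in \<open>force simp: energy_density_add_period\<close>)+
    moreover have "ennreal (min 0 x) = 0" for x by (simp add: ennreal_neg)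
    ultimately show ?thesis unfolding energy_def torus_integral_def by (simp add: enn2ereal_minus_zero[simplified])
  qed
  have E4: "energy4 L \<Phi> f = enn2ereal E4"
  proof -
    have S: "AE s in lborel. s \<in> {s. T s = tangent f s}" using cc(2) by simp
    have "torus_nn_integral L (\<lambda>s t. Theta \<Phi> (norm (f s - f t)) * (1 - tangent f s \<bullet> tangent f t) / \<Phi> (norm (f s - f t))) = E4"
      unfolding E4_def by (rule torus_nn_integral_eq[OF _ _ S]) (use energy4_density_eq in \<open>auto simp: energy4_density_add_period\<close>)
    moreover have "torus_nn_integral L (\<lambda>s t. - (Theta \<Phi> (norm (f s - f t)) * (1 - tangent f s \<bullet> tangent f t) / \<Phi> (norm (f s - f t)))) =
        (\<integral>\<^sup>+p\<in>off_diag. ennreal (min 0 (- energy4_density (fst p) (snd p))) \<partial>(lborel \<Otimes>\<^sub>M lborel))"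
      by (rule torus_nn_integral_eq[OF _ _ S, where g="\<lambda>s t. min 0 (- energy4_density s t)"])
        (use energy4_density_eq in \<open>force simp: energy4_density_add_period\<close>)+
    moreover have "ennreal (min 0 x) = 0" for x by (simp add: ennreal_neg)
    ultimately show ?thesis unfolding energy4_def torus_integral_def by (simp add: enn2ereal_minus_zero[simplified])
  qed
  have lims: "((\<lambda>\<epsilon>. \<epsilon> * (LINT s:{0..<L}|lborel. Lambda \<Phi> (norm (f s - f (s + \<epsilon>))) - Lambda \<Phi> \<epsilon>)) \<longlongrightarrow> 0) (at_right 0)"
    "((\<lambda>\<epsilon>. LINT s:{0..<L}|lborel. Lambda \<Phi> (norm (f s - f (s + \<epsilon>))) *
        (LINT t:{s..s + \<epsilon>}|lborel. (norm (tangent f s - tangent f t))\<^sup>2)) \<longlongrightarrow> 0) (at_right 0)"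
    using A4 W bl curve unfolding cond_A4_def arclength_closed_curve_def by blast+
  have "E = E4 + E3 + ennreal (2 * L * H (L / 2))"
    unfolding E_def E4_def E3_def
  proof (rule energy_decomposition[OF adm])
    show "((\<lambda>\<epsilon>. \<epsilon> * (LINT s:{0..<L}|lborel. Lam (norm (f s - f (s + \<epsilon>))) - Lam \<epsilon>)) \<longlongrightarrow> 0) (at_right 0)"
      using lims(1) by (rule Lim_transform_eventually)
        (auto simp: eventually_at_filter Lam_eq intro!: always_eventually)
    \<comment> \<open>Replacing \<open>tangent f\<close> by \<open>T\<close> takes two
      almost-everywhere arguments: the outer one fixes an \<open>s\<close> where both agree, the
      inner one handles \<open>t\<close>.\<close>
    have osc: "(LINT s:{0..<L}|lborel. Lam (norm (f s - f (s + \<epsilon>))) *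
          (LINT t:{s..s + \<epsilon>}|lborel. (norm (tangent f s - tangent f t))\<^sup>2)) =
        (LINT s:{0..<L}|lborel. Lam (norm (f s - f (s + \<epsilon>))) *
          (LINT t:{s..s + \<epsilon>}|lborel. (norm (T s - T t))\<^sup>2))" for \<epsilon>
      unfolding set_lebesgue_integral_def[of lborel "{0..<L}"]
    proof (rule integral_cong_AE)
      show "AE s in lborel. indicator {0..<L} s *\<^sub>R (Lam (norm (f s - f (s + \<epsilon>))) *
            (LINT t:{s..s + \<epsilon>}|lborel. (norm (tangent f s - tangent f t))\<^sup>2)) =
          indicator {0..<L} s *\<^sub>R (Lam (norm (f s - f (s + \<epsilon>))) *
            (LINT t:{s..s + \<epsilon>}|lborel. (norm (T s - T t))\<^sup>2))"
        using cc(2)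
      proof eventually_elim
        case (elim s)
        have "(LINT t:{s..s + \<epsilon>}|lborel. (norm (tangent f s - tangent f t))\<^sup>2) =
            (LINT t:{s..s + \<epsilon>}|lborel. (norm (T s - T t))\<^sup>2)"
          unfolding set_lebesgue_integral_def
        proof (rule integral_cong_AE)
          show "AE t in lborel. indicator {s..s + \<epsilon>} t *\<^sub>R (norm (tangent f s - tangent f t))\<^sup>2 =
              indicator {s..s + \<epsilon>} t *\<^sub>R (norm (T s - T t))\<^sup>2"
            using cc(2) by eventually_elim (simp add: elim)
        qed measurable
        then show ?case by simp
      qed
    qed (measurable, (rule borel_measurable_oscillation, measurable)+)
    show "((\<lambda>\<epsilon>. LINT s:{0..<L}|lborel. Lam (norm (f s - f (s + \<epsilon>))) *
        (LINT t:{s..s + \<epsilon>}|lborel. (norm (T s - T t))\<^sup>2)) \<longlongrightarrow> 0) (at_right 0)"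
      using lims(2) by (simp add: Lam_eq osc)
    show "(\<integral>\<^sup>+p\<in>off_diag. ennreal (energy_density (fst p) (snd p)) \<partial>(lborel \<Otimes>\<^sub>M lborel)) < \<infinity>"
      using fin unfolding E E_def[symmetric] by (simp add: less_ennreal.rep_eq top_ennreal.rep_eq)
  qed
  then have "enn2ereal E = enn2ereal E4 + enn2ereal E3 + enn2ereal (ennreal (2 * L * H (L / 2)))"
    by (simp add: plus_ennreal.rep_eq)
  \<comment> \<open>This is \<open>H x = - x * Lam x\<close> at \<open>x = L / 2\<close>, multiplied
    by \<open>2 * L\<close>.\<close>
  also have "enn2ereal (ennreal (2 * L * H (L / 2))) = - ereal (L\<^sup>2 * Lambda \<Phi> (L / 2))"
    using L H_nonneg by (simp add: enn2ereal_ennreal Lam_eq Lam_def power2_eq_square)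
  finally have decomp: "energy L \<Phi> f = energy4 L \<Phi> f + enn2ereal E3 - ereal (L\<^sup>2 * Lambda \<Phi> (L / 2))"
    by (simp add: E E4 minus_ereal_def)
  show ?thesis
  proof (rule that[OF _ decomp])
    assume *: "\<And>s t. 1 + tangent f s \<bullet> tangent f t =
       2 * (((f s - f t) \<bullet> tangent f s) * ((f s - f t) \<bullet> tangent f t) / (norm (f s - f t))\<^sup>2) \<or> f s = f t"
    have "torus_nn_integral L (\<lambda>s t. 0) = E3"
      unfolding E3_def
    proof (rule torus_nn_integral_eq)
      show "AE s in lborel. s \<in> {s. T s = tangent f s}" using cc(2) by simp
      fix s t assume "s \<in> {s. T s = tangent f s}" "t \<in> {s. T s = tangent f s}"
        "0 \<le> s" "s < L" "0 \<le> t" "t < L" "s \<noteq> t"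
      then show "0 = defect_density s t" using chord_pos[of s t] *[of s t] by (auto simp: defect_density_def)
    qed (auto simp: defect_density_def f_add_period T_add_period)
    then show "enn2ereal E3 = 0" by (simp add: torus_nn_integral_def zero_ennreal.rep_eq)
  qed simp
qed

text \<open>Both tangents have the same inner product \<open>r * y\<close> with the chord vector.
  With \<open>x\<close> and \<open>y\<close> the cosine and sine of the angle difference, the claim
  reduces to \<open>(1 + x) * (2 - 2 * x) = 2 * y^2\<close>, and distinct points give
  \<open>x < 1\<close>, so the division is legitimate.\<close>

lemma round_circle_chord_identity:
  fixes C :: "real \<Rightarrow> real^'n"
  assumes "round_circle L C" "L > 0"
  shows "1 + tangent C s \<bullet> tangent C t =
    2 * (((C s - C t) \<bullet> tangent C s) * ((C s - C t) \<bullet> tangent C t) / (norm (C s - C t))\<^sup>2) \<or> C s = C t"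
proof -
  obtain p u v where uv: "norm u = 1" "norm v = 1" "u \<bullet> v = 0"
    and C: "\<And>s. C s = p + (L / (2 * pi)) *\<^sub>R (cos (2 * pi * s / L) *\<^sub>R u + sin (2 * pi * s / L) *\<^sub>R v)"
    using assms(1) by (auto simp: round_circle_def)
  have uu: "u \<bullet> u = 1" "v \<bullet> v = 1" "v \<bullet> u = 0" using uv by (simp_all add: norm_eq_1 inner_commute)
  define r \<theta> where "r = L / (2 * pi)" and "\<theta> s = 2 * pi * s / L" for s
  have r: "0 < r" using assms(2) by (simp add: r_def)
  have C_eq: "C s = p + r *\<^sub>R (cos (\<theta> s) *\<^sub>R u + sin (\<theta> s) *\<^sub>R v)" for s
    by (simp add: C r_def \<theta>_def)
  have "(C has_vector_derivative (- sin (\<theta> s)) *\<^sub>R u + cos (\<theta> s) *\<^sub>R v) (at s)" for s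
  proof -
    have c: "((\<lambda>s. cos (\<theta> s)) has_real_derivative - sin (\<theta> s) / r) (at s)"
      and s: "((\<lambda>s. sin (\<theta> s)) has_real_derivative cos (\<theta> s) / r) (at s)"
      using assms(2) unfolding \<theta>_def r_def by (auto intro!: derivative_eq_intros simp: field_simps)
    note has_vector_derivative_add[OF has_vector_derivative_scaleR[OF c has_vector_derivative_const[of u]]
        has_vector_derivative_scaleR[OF s has_vector_derivative_const[of v]]]
    from has_vector_derivative_add[OF has_vector_derivative_const[of p]
        has_vector_derivative_scaleR[OF DERIV_const[of r] this]]
    show ?thesis unfolding C_eq[abs_def]
      by (rule has_vector_derivative_eq_rhs) (use r in \<open>simp add: scaleR_add_right scaleR_diff_right\<close>)
  qed
  then have tan: "tangent C s = (- sin (\<theta> s)) *\<^sub>R u + cos (\<theta> s) *\<^sub>R v" for s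
    unfolding tangent_def by (rule vector_derivative_at)
  define x where "x = cos (\<theta> s - \<theta> t)"
  define y where "y = sin (\<theta> s - \<theta> t)"
  have xy: "y\<^sup>2 = 1 - x\<^sup>2" unfolding x_def y_def by (simp add: sin_squared_eq)
  have diff: "C s - C t = r *\<^sub>R ((cos (\<theta> s) - cos (\<theta> t)) *\<^sub>R u + (sin (\<theta> s) - sin (\<theta> t)) *\<^sub>R v)"
    by (simp add: C_eq algebra_simps)
  have 1: "tangent C s \<bullet> tangent C t = x"
    by (simp add: tan x_def cos_diff inner_add_left inner_add_right inner_diff_left inner_diff_right uu uv)
  have 2: "(C s - C t) \<bullet> tangent C s = r * y"
    by (simp add: tan diff y_def sin_diff inner_add_left inner_add_right inner_diff_left inner_diff_right uu uv algebra_simps)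
  have 3: "(C s - C t) \<bullet> tangent C t = r * y"
    by (simp add: tan diff y_def sin_diff inner_add_left inner_add_right inner_diff_left inner_diff_right uu uv algebra_simps)
  have 4: "(norm (C s - C t))\<^sup>2 = r\<^sup>2 * (2 - 2 * x)"
  proof -
    have "(norm (r *\<^sub>R (a *\<^sub>R u + b *\<^sub>R v)))\<^sup>2 = r\<^sup>2 * (a\<^sup>2 + b\<^sup>2)" for a b
      unfolding power2_norm_eq_inner
      by (simp add: inner_add_left inner_add_right uu uv power2_eq_square algebra_simps)
    then have "(norm (C s - C t))\<^sup>2 = r\<^sup>2 * ((cos (\<theta> s) - cos (\<theta> t))\<^sup>2 + (sin (\<theta> s) - sin (\<theta> t))\<^sup>2)"
      unfolding diff .
    also have "(cos (\<theta> s) - cos (\<theta> t))\<^sup>2 + (sin (\<theta> s) - sin (\<theta> t))\<^sup>2 =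
        ((sin (\<theta> s))\<^sup>2 + (cos (\<theta> s))\<^sup>2) + ((sin (\<theta> t))\<^sup>2 + (cos (\<theta> t))\<^sup>2) - 2 * x"
      unfolding x_def cos_diff by (simp add: power2_eq_square algebra_simps)
    finally show ?thesis by simp
  qed
  show ?thesis
  proof (cases "C s = C t")
    case False
    then have "0 < r\<^sup>2 * (2 - 2 * x)" unfolding 4[symmetric] by simp
    then have "x < 1" using r by (simp add: zero_less_mult_iff)
    moreover have "(1 + x) * (2 - 2 * x) = 2 * y\<^sup>2" unfolding xy by (simp add: power2_eq_square algebra_simps)
    ultimately have "1 + x = 2 * (y\<^sup>2 / (2 - 2 * x))" by (simp add: field_simps)
    then show ?thesis unfolding 1 2 3 4 using r by (simp add: power2_eq_square)
  qed simp
qed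

theorem corollary2p1:
  fixes L :: real and \<Phi> :: "real \<Rightarrow> real" and C :: "real \<Rightarrow> real^'n"
  assumes "L > 0"
    and "CARD('n) \<ge> 2"
    and "\<forall>t>0. \<Phi> t > 0"
    and "cond_A1 \<Phi>"
    and "cond_A2 \<Phi>"
    and "cond_A3 TYPE('n) L \<Phi>"
    and "cond_A4 TYPE('n) L \<Phi>"
    and "cond_A5b L \<Phi>"
    and "round_circle L C"
    and "C \<in> finite_energy_curves L \<Phi>"
    and "\<forall>f \<in> (finite_energy_curves L \<Phi> :: (real \<Rightarrow> real^'n) set). energy4 L \<Phi> C \<le> energy4 L \<Phi> f"
  shows "\<forall>f \<in> (finite_energy_curves L \<Phi> :: (real \<Rightarrow> real^'n) set). energy L \<Phi> C \<le> energy L \<Phi> f"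
proof
  fix f :: "real \<Rightarrow> real^'n" assume f: "f \<in> finite_energy_curves L \<Phi>"
  note decomposition = energy_eq_energy4[OF assms(1,3-8)]
  have "energy L \<Phi> C = energy4 L \<Phi> C - ereal (L\<^sup>2 * Lambda \<Phi> (L / 2))"
    using decomposition[OF assms(10)] round_circle_chord_identity[OF assms(9,1)]
    by (metis add.right_neutral)
  also have "\<dots> \<le> energy4 L \<Phi> f - ereal (L\<^sup>2 * Lambda \<Phi> (L / 2))"
    using assms(11) f by (intro ereal_minus_mono) auto
  also obtain d where "0 \<le> d" "energy L \<Phi> f = energy4 L \<Phi> f + d - ereal (L\<^sup>2 * Lambda \<Phi> (L / 2))"
    using decomposition[OF f] by metis
  then have "energy4 L \<Phi> f - ereal (L\<^sup>2 * Lambda \<Phi> (L / 2)) \<le> energy L \<Phi> f"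
    by (simp add: ereal_minus_mono add_increasing2)
  finally show "energy L \<Phi> C \<le> energy L \<Phi> f" .
qed

end
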